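(* The coefficients of the series $$\mathbb{L}(z)=\mathrm{tr}_{1,\ldots,N}\,A_{(N)}\,\mathcal{L}_1(z)\,\mathcal{L}_2(z-h)\cdots\mathcal{L}_N(z-(N-1)h)\in\widetilde{\mathrm{Y}}(\widehat{R})[[z^{\pm1}]]$$ belong to the center of $\widetilde{\mathrm{Y}}(\widehat{R})$.
   Context: Fix an integer $N\geq2$ and a formal parameter $h$. Let $\widehat{R}(u)=uI-hP\in\mathrm{End}\,\mathbb{C}^N\otimes\mathrm{End}\,\mathbb{C}^N[u,h]$, where $I$ is the identity and $P$ the permutation operator on $\mathbb{C}^N\otimes\mathbb{C}^N$. $\mathrm{Y}(\widehat{R})$ is the associative algebra over $\mathbb{C}[[h]]$ generated by $\lambda_{ij}^{(r)}$, $r\in\mathbb{Z}$, $i,j=1,\ldots,N$, subject to $$\widehat{R}(u-v)\mathcal{L}_1(u)\mathcal{L}_2(v)=\mathcal{L}_2(v)\mathcal{L}_1(u)\widehat{R}(u-v),$$ where $\mathcal{L}(u)=\sum_{i,j=1}^Ne_{ij}\otimes\lambda_{ij}(u)$, $\lambda_{ij}(u)=\sum_{r\in\mathbb{Z}}\lambda_{ij}^{(-r)}u^r$, $e_{ij}$ are matrix units, and $\mathcal{L}_k(u)$ is the copy of $\mathcal{L}(u)$ whose matrix part acts on the $k$-th tensor factor. For $p\geq0$ let $I_p$ be the two-sided ideal of $\mathrm{Y}(\widehat{R})$ generated by $h^{p+1}$ and all $\lambda_{ij}^{(-r)}$ with $r>p$; the completed algebra is $\widetilde{\mathrm{Y}}(\widehat{R})=\varprojlim\mathrm{Y}(\widehat{R})/I_p$.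 Expressions $(z+ch)^r$, $r\in\mathbb{Z}$, $c\in\mathbb{C}$, are expanded in nonnegative powers of $h$. $A_{(N)}$ is the operator on $(\mathbb{C}^N)^{\otimes N}$ given by the action of the normalized anti-symmetrizer $\frac{1}{N!}\sum_{p\in\mathfrak{S}_N}\mathrm{sgn}(p)\,p$, with $\mathfrak{S}_N$ permuting the tensor factors. $\mathrm{tr}_{1,\ldots,N}$ is the trace over the $N$ tensor factors $\mathrm{End}\,\mathbb{C}^N$. *)

theory Defs
  imports
    "HOL-Algebra.Algebraic_Closure_Type"
    "HOL-Library.Cardinality"
    "HOL-Combinatorics.Permutations"
    "HOL-Computational_Algebra.Formal_Power_Series"
    "HOL-Library.Poly_Mapping"
begin

section \<open>Center, and inverse limits of quotients\<close>

definition ring_center :: "('a, 'b) ring_scheme \<Rightarrow> 'a set" where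
  "ring_center R = {x \<in> carrier R. \<forall>y \<in> carrier R. x \<otimes>\<^bsub>R\<^esub> y = y \<otimes>\<^bsub>R\<^esub> x}"

text \<open>
  The inverse limit of the quotients \<open>R Quot I p\<close> along the canonical projections
  \<open>I q +> y \<mapsto> I p +> y\<close> for \<open>p \<le> q\<close>, where \<open>I\<close> is a decreasing sequence of ideals.
\<close>

definition inv_lim :: "('a, 'b) ring_scheme \<Rightarrow> (nat \<Rightarrow> 'a set) \<Rightarrow> (nat \<Rightarrow> 'a set) ring" where
  "inv_lim R I =
    \<lparr>carrier = {x. (\<forall>p. x p \<in> carrier (R Quot I p)) \<and>
        (\<forall>p q. p \<le> q \<longrightarrow> (\<forall>y \<in> carrier R. x q = I q +>\<^bsub>R\<^esub> y \<longrightarrow> x p = I p +>\<^bsub>R\<^esub> y))},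
     monoid.mult = (\<lambda>x y p. x p \<otimes>\<^bsub>R Quot I p\<^esub> y p),
     one = (\<lambda>p. \<one>\<^bsub>R Quot I p\<^esub>),
     zero = (\<lambda>p. \<zero>\<^bsub>R Quot I p\<^esub>),
     add = (\<lambda>x y p. x p \<oplus>\<^bsub>R Quot I p\<^esub> y p)\<rparr>"

definition inv_lim_map :: "('a, 'b) ring_scheme \<Rightarrow> (nat \<Rightarrow> 'a set) \<Rightarrow> 'a \<Rightarrow> nat \<Rightarrow> 'a set" where
  "inv_lim_map R I y = (\<lambda>p. I p +>\<^bsub>R\<^esub> y)"

text \<open>
  Unordered infinite sums in the inverse limit: in each quotient only finitely many summands
  are nonzero.  The value of \<open>inv_lim_sum\<close> is unspecified if the family is not summable.
\<close>

definition inv_lim_has_sum ::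
    "('a, 'b) ring_scheme \<Rightarrow> (nat \<Rightarrow> 'a set) \<Rightarrow> ('i \<Rightarrow> nat \<Rightarrow> 'a set) \<Rightarrow> 'i set \<Rightarrow> (nat \<Rightarrow> 'a set) \<Rightarrow> bool" where
  "inv_lim_has_sum R I f A x \<longleftrightarrow>
    (\<forall>i \<in> A. f i \<in> carrier (inv_lim R I)) \<and> x \<in> carrier (inv_lim R I) \<and>
    (\<forall>p. finite {i \<in> A. f i p \<noteq> \<zero>\<^bsub>R Quot I p\<^esub>} \<and>
         x p = (\<Oplus>\<^bsub>R Quot I p\<^esub> i \<in> {i \<in> A. f i p \<noteq> \<zero>\<^bsub>R Quot I p\<^esub>}. f i p))"

definition inv_lim_sum ::
    "('a, 'b) ring_scheme \<Rightarrow> (nat \<Rightarrow> 'a set) \<Rightarrow> ('i \<Rightarrow> nat \<Rightarrow> 'a set) \<Rightarrow> 'i set \<Rightarrow> nat \<Rightarrow> 'a set" where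
  "inv_lim_sum R I f A = (THE x. inv_lim_has_sum R I f A x)"


section \<open>Operators on tensor powers with coefficients in a ring\<close>

text \<open>
  A finite type \<open>'n\<close> with \<open>N\<close> elements labels the standard basis of \<open>\<complex>\<^sup>N\<close>.  The basis of the
  \<open>m\<close>-th tensor power is labelled by the lists of length \<open>m\<close> over \<open>'n\<close>, with the tensor factors
  numbered \<open>0, \<dots>, m - 1\<close>.  An element of \<open>(End \<complex>\<^sup>N)\<^sup>\<otimes>\<^sup>m \<otimes> R\<close> is given by its matrix entries;
  only those with row and column index in \<open>multi_indices m\<close> matter.
\<close>

type_synonym ('n, 'a) tensor_mat = "'n list \<Rightarrow> 'n list \<Rightarrow> 'a"

definition multi_indices :: "nat \<Rightarrow> 'n list set" where
  "multi_indices m = {I. length I = m}"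

definition tensor_mult ::
    "('a, 'b) ring_scheme \<Rightarrow> nat \<Rightarrow> ('n, 'a) tensor_mat \<Rightarrow> ('n, 'a) tensor_mat \<Rightarrow> ('n, 'a) tensor_mat" where
  "tensor_mult R m A B = (\<lambda>I J. \<Oplus>\<^bsub>R\<^esub> K \<in> multi_indices m. A I K \<otimes>\<^bsub>R\<^esub> B K J)"

definition tensor_one :: "('a, 'b) ring_scheme \<Rightarrow> ('n, 'a) tensor_mat" where
  "tensor_one R = (\<lambda>I J. if I = J then \<one>\<^bsub>R\<^esub> else \<zero>\<^bsub>R\<^esub>)"

text \<open>The copy of a matrix \<open>x\<close> over \<open>R\<close> acting on the \<open>k\<close>-th of \<open>m\<close> tensor factors.\<close>

definition tensor_leg ::
    "('a, 'b) ring_scheme \<Rightarrow> nat \<Rightarrow> nat \<Rightarrow> ('n \<Rightarrow> 'n \<Rightarrow> 'a) \<Rightarrow> ('n, 'a) tensor_mat" where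
  "tensor_leg R m k x =
    (\<lambda>I J. if \<forall>l<m. l \<noteq> k \<longrightarrow> I ! l = J ! l then x (I ! k) (J ! k) else \<zero>\<^bsub>R\<^esub>)"

definition tensor_trace :: "('a, 'b) ring_scheme \<Rightarrow> nat \<Rightarrow> ('n, 'a) tensor_mat \<Rightarrow> 'a" where
  "tensor_trace R m A = (\<Oplus>\<^bsub>R\<^esub> I \<in> multi_indices m. A I I)"

text \<open>The operator sending the basis vector \<open>J\<close> to the \<open>I\<close> with \<open>J ! k\<close> in position \<open>\<sigma> k\<close>.\<close>

definition perm_op :: "nat \<Rightarrow> (nat \<Rightarrow> nat) \<Rightarrow> ('n, 'a::zero_neq_one) tensor_mat" where
  "perm_op m \<sigma> = (\<lambda>I J. if \<forall>k<m. I ! (\<sigma> k) = J ! k then 1 else 0)"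

definition antisymmetrizer :: "nat \<Rightarrow> ('n, complex) tensor_mat" where
  "antisymmetrizer m =
    (\<lambda>I J. (\<Sum>\<sigma> | \<sigma> permutes {..<m}. of_int (sign \<sigma>) * perm_op m \<sigma> I J) / fact m)"


section \<open>The algebra \<open>Y(R)\<close>\<close>

datatype 'g free_mon = Free_Mon "'g list"

instantiation free_mon :: (type) monoid_add
begin

definition zero_free_mon :: "'a free_mon" where
  "zero_free_mon = Free_Mon []"

fun plus_free_mon :: "'a free_mon \<Rightarrow> 'a free_mon \<Rightarrow> 'a free_mon" where
  "plus_free_mon (Free_Mon xs) (Free_Mon ys) = Free_Mon (xs @ ys)"

instance
proof
  fix a b c :: "'a free_mon"
  show "a + b + c = a + (b + c)" by (cases a; cases b; cases c) simp
  show "0 + a = a" by (cases a) (simp add: zero_free_mon_def)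
  show "a + 0 = a" by (cases a) (simp add: zero_free_mon_def)
qed

end

text \<open>
  The free associative unital algebra over \<open>\<complex>[[h]]\<close> on the generators \<open>(i, j, r)\<close>, which stand
  for \<open>\<lambda>\<^sub>i\<^sub>j\<^sup>(\<^sup>r\<^sup>)\<close>; the formal parameter \<open>h\<close> is \<open>fps_X\<close>.
\<close>

type_synonym 'n free_alg = "('n \<times> 'n \<times> int) free_mon \<Rightarrow>\<^sub>0 complex fps"

abbreviation free_alg_ring :: "'n free_alg ring" where
  "free_alg_ring \<equiv> ring_of_type_algebra"

definition scalar :: "complex fps \<Rightarrow> 'n free_alg" where
  "scalar c = Poly_Mapping.single 0 c"

definition lam :: "'n \<Rightarrow> 'n \<Rightarrow> int \<Rightarrow> 'n free_alg" where
  "lam i j r = Poly_Mapping.single (Free_Mon [(i, j, r)]) 1"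

text \<open>The coefficient of \<open>u\<^sup>r\<close> in \<open>\<L>(u)\<close>; note the sign of the exponent.\<close>

definition L_coeff :: "int \<Rightarrow> 'n \<Rightarrow> 'n \<Rightarrow> 'n free_alg" where
  "L_coeff r = (\<lambda>i j. lam i j (- r))"

text \<open>The coefficient of \<open>x\<^sup>k\<close> in \<open>R(x) = x I - h P\<close>.\<close>

definition R_coeff :: "nat \<Rightarrow> ('n, complex fps) tensor_mat" where
  "R_coeff k = (\<lambda>I J.
     if k = 0 then - fps_X * perm_op 2 (Transposition.transpose 0 1) I J
     else if k = 1 then (if I = J then 1 else 0)
     else 0)"

text \<open>The coefficient of \<open>u\<^sup>c v\<^sup>d\<close> in \<open>R(u - v)\<close>, by the binomial theorem.\<close>

definition R_diff_coeff :: "nat \<Rightarrow> nat \<Rightarrow> ('n, 'n free_alg) tensor_mat" where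
  "R_diff_coeff c d = (\<lambda>I J. scalar ((-1) ^ d * of_nat ((c + d) choose d) * R_coeff (c + d) I J))"

text \<open>
  The coefficients of \<open>u\<^sup>a v\<^sup>b\<close> in \<open>R(u - v) \<L>\<^sub>1(u) \<L>\<^sub>2(v)\<close> and \<open>\<L>\<^sub>2(v) \<L>\<^sub>1(u) R(u - v)\<close>.
  As \<open>R\<close> has degree 1, only the coefficients of \<open>R(u - v)\<close> with \<open>c, d \<le> 1\<close> contribute.
\<close>

definition RLL_lhs :: "int \<Rightarrow> int \<Rightarrow> ('n::finite, 'n free_alg) tensor_mat" where
  "RLL_lhs a b = (\<lambda>I J. \<Sum>c\<le>1. \<Sum>d\<le>1.
     tensor_mult free_alg_ring 2 (R_diff_coeff c d)
       (tensor_mult free_alg_ring 2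
         (tensor_leg free_alg_ring 2 0 (L_coeff (a - int c)))
         (tensor_leg free_alg_ring 2 1 (L_coeff (b - int d)))) I J)"

definition RLL_rhs :: "int \<Rightarrow> int \<Rightarrow> ('n::finite, 'n free_alg) tensor_mat" where
  "RLL_rhs a b = (\<lambda>I J. \<Sum>c\<le>1. \<Sum>d\<le>1.
     tensor_mult free_alg_ring 2
       (tensor_mult free_alg_ring 2
         (tensor_leg free_alg_ring 2 1 (L_coeff (b - int d)))
         (tensor_leg free_alg_ring 2 0 (L_coeff (a - int c))))
       (R_diff_coeff c d) I J)"

definition RLL_ideal :: "'n::finite free_alg set" where
  "RLL_ideal = Idl\<^bsub>free_alg_ring\<^esub>
     {RLL_lhs a b I J - RLL_rhs a b I J | a b I J. I \<in> multi_indices 2 \<and> J \<in> multi_indices 2}"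

definition Y_alg :: "'n::finite free_alg set ring" where
  "Y_alg = free_alg_ring Quot RLL_ideal"

definition Y_class :: "'n::finite free_alg \<Rightarrow> 'n free_alg set" where
  "Y_class x = RLL_ideal +>\<^bsub>free_alg_ring\<^esub> x"


section \<open>The completed algebra\<close>

definition Y_filt :: "nat \<Rightarrow> 'n::finite free_alg set set" where
  "Y_filt p = Idl\<^bsub>Y_alg\<^esub>
     (insert (Y_class (scalar (fps_X ^ (p + 1)))) {Y_class (lam i j (- r)) | i j r. r > int p})"

type_synonym 'n Y_compl_elem = "nat \<Rightarrow> 'n free_alg set set"

definition Y_compl :: "'n::finite Y_compl_elem ring" where
  "Y_compl = inv_lim Y_alg Y_filt"

definition to_Y_compl :: "'n::finite free_alg \<Rightarrow> 'n Y_compl_elem" where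
  "to_Y_compl x = inv_lim_map Y_alg Y_filt (Y_class x)"

abbreviation Y_compl_sum :: "('i \<Rightarrow> 'n::finite Y_compl_elem) \<Rightarrow> 'i set \<Rightarrow> 'n Y_compl_elem" where
  "Y_compl_sum \<equiv> inv_lim_sum Y_alg Y_filt"


section \<open>The series \<open>\<bbbL>(z)\<close>\<close>

text \<open>
  The coefficient of \<open>z\<^sup>n\<close> in \<open>(z + c h)\<^sup>r\<close>, expanded in nonnegative powers of \<open>h\<close>:
  the term \<open>binom(r, s) c\<^sup>s h\<^sup>s z\<^bsup>r - s\<^esup>\<close> with \<open>s = r - n\<close>.
\<close>

definition shift_pow_coeff :: "complex \<Rightarrow> int \<Rightarrow> int \<Rightarrow> complex fps" where
  "shift_pow_coeff c r n =
    (if n \<le> r then fps_const ((of_int r gchoose nat (r - n)) * c ^ nat (r - n)) * fps_X ^ nat (r - n)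
     else 0)"

text \<open>The coefficient of \<open>z\<^sup>n\<close> in \<open>\<L>(z + c h)\<close>.\<close>

definition L_shift_coeff :: "complex \<Rightarrow> int \<Rightarrow> 'n \<Rightarrow> 'n \<Rightarrow> 'n::finite Y_compl_elem" where
  "L_shift_coeff c n = (\<lambda>i j.
     Y_compl_sum (\<lambda>r. to_Y_compl (scalar (shift_pow_coeff c r n) * L_coeff r i j)) UNIV)"

text \<open>
  Series in \<open>z\<^sup>\<plusminus>\<^sup>1\<close> with coefficients in \<open>(End \<complex>\<^sup>N)\<^sup>\<otimes>\<^sup>m\<close> tensored with the completed algebra,
  given by their coefficients, and their Cauchy product.
\<close>

type_synonym 'n Y_mat_series = "int \<Rightarrow> ('n, 'n Y_compl_elem) tensor_mat"

definition Y_series_one :: "'n::finite Y_mat_series" where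
  "Y_series_one n = (if n = 0 then tensor_one Y_compl else (\<lambda>I J. \<zero>\<^bsub>Y_compl\<^esub>))"

definition Y_series_mult :: "nat \<Rightarrow> 'n Y_mat_series \<Rightarrow> 'n Y_mat_series \<Rightarrow> 'n::finite Y_mat_series" where
  "Y_series_mult m A B n = (\<lambda>I J.
     Y_compl_sum (\<lambda>k. tensor_mult Y_compl m (A k) (B (n - k)) I J) UNIV)"

text \<open>
  The product \<open>\<L>\<^sub>1(z) \<L>\<^sub>2(z - h) \<dots> \<L>\<^sub>k(z - (k - 1) h)\<close> on \<open>m\<close> tensor factors.  With the factors
  numbered from 0, the \<open>k\<close>-th factor carries the shift \<open>- k h\<close>.
\<close>

primrec L_prod :: "nat \<Rightarrow> nat \<Rightarrow> 'n::finite Y_mat_series" where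
  "L_prod m 0 = Y_series_one"
| "L_prod m (Suc k) = Y_series_mult m (L_prod m k)
     (\<lambda>n. tensor_leg Y_compl m k (L_shift_coeff (- of_nat k) n))"

text \<open>The coefficient of \<open>z\<^sup>n\<close> in \<open>\<bbbL>(z)\<close>.\<close>

definition LL_coeff :: "int \<Rightarrow> 'n::finite Y_compl_elem" where
  "LL_coeff n = tensor_trace Y_compl CARD('n)
     (tensor_mult Y_compl CARD('n)
        (\<lambda>I J. to_Y_compl (scalar (fps_const (antisymmetrizer CARD('n) I J))))
        (L_prod CARD('n) CARD('n) n))"

end

theory Submission
  imports Defs "HOL-Computational_Algebra.Formal_Laurent_Series"
begin

text \<open>
  An element of the inverse limit is central as soon as its image in every quotient
  \<open>Y / I\<^sub>p\<close> commutes with the generators.  Modulo \<open>I\<^sub>p\<close> the coefficients of \<open>\<L>(u)\<close> vanish above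
  degree \<open>p\<close>.  So \<open>\<L>(u)\<close> becomes a Laurent series in \<open>u\<^sup>-\<^sup>1\<close>, products of such series in \<open>u\<close> and
  \<open>z\<close> make sense, and the monic linear factors \<open>u - z + c h\<close> can be cancelled.  In the quotient
  the argument is that for the quantum determinant of the Yangian, in two steps.

  \<^emph>\<open>Fusion.\<close>  At \<open>u - v = h\<close> the \<open>R\<close>-matrix is \<open>h (1 - P)\<close>, which suggests
  \<open>(1 - P) \<L>\<^sub>1(v + h) \<L>\<^sub>2(v) = \<L>\<^sub>2(v) \<L>\<^sub>1(v + h) (1 - P)\<close>; but the substitution only gives \<open>h\<close>
  times this relation, and \<open>h\<close> is nilpotent modulo \<open>I\<^sub>p\<close>.  The factor is removed as follows.  The
  defining relation reads \<open>(u - v) C(u, v) = h D(u, v)\<close>, where \<open>C\<close> is a commutator of two entries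
  and \<open>D\<close> is antisymmetric in \<open>u\<close> and \<open>v\<close>.  By the antisymmetry \<open>D = (u - v) Q\<close> for a series \<open>Q\<close>
  that is again bounded above in both variables, and cancelling \<open>u - v\<close> gives \<open>C = h Q\<close>.  Now
  \<open>u = v + h\<close> gives \<open>D = h Q = C\<close>, which is the fused relation (\<open>fused_exchange\<close>).  It follows that
  a combination of the products \<open>\<L>\<^sub>1(z) \<dots> \<L>\<^sub>N(z - (N - 1) h)\<close> that is alternating in the row
  indices is alternating in the column indices too (\<open>alternating_minor\<close>).

  \<^emph>\<open>Moving a generator.\<close>  Applying the defining relation once for each factor takes
  \<open>\<L>\<^sub>0(u)\<close> from the left of the product to its right, at the cost of a chain of \<open>R\<close>-matrices
  \<open>R\<^sub>0\<^sub>k(u - z + k h)\<close> on the row indices on one side and on the column indices on the other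
  (\<open>pairing_chain\<close>).  On alternating tensors in \<open>N\<close> factors over an \<open>N\<close>-dimensional space this
  chain is multiplication by a product of factors \<open>u - z + c h\<close> (\<open>R_chain_op_alternating\<close>).  The
  same scalar appears on both sides and can be cancelled, so every entry of \<open>\<L>(u)\<close> commutes with
  the alternating combination (\<open>minor_commute\<close>).  The trace defining the series of the theorem is a sum
  of such combinations (\<open>crit_val_LL_coeff\<close>).

  Both steps are carried out in a ring that is given by a type, for a family of elements that satisfies
  the relations of a fixed level \<open>p\<close>.  To apply them, \<open>Y / I\<^sub>p\<close> has to be a type.
  A type cannot depend on a variable \<open>p\<close>, but it can depend on a constant: take for \<open>p\<close> a level at
  which commutation fails, if there is one.  If commutation holds at this critical level, it holds
  at every level.
\<close>

unbundle fps_syntax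

section \<open>Alternating functions and exchange operators\<close>

text \<open>
  Vanishing on repeated indices is part of the definition because it follows from the sign rule
  only where \<open>y + y = 0\<close> implies \<open>y = 0\<close>.
\<close>
definition alternating :: "nat \<Rightarrow> ('n list \<Rightarrow> 'a::ring_1) \<Rightarrow> bool" where
  "alternating N f \<longleftrightarrow> (\<forall>J p q. length J = N \<longrightarrow> p < N \<longrightarrow> q < N \<longrightarrow> p \<noteq> q \<longrightarrow>
     f (J[p := J ! q, q := J ! p]) = - f J \<and> (J ! p = J ! q \<longrightarrow> f J = 0))"

lemma alternatingD:
  assumes "alternating N f" "length J = N" "p < N" "q < N" "p \<noteq> q"
  shows "f (J[p := J ! q, q := J ! p]) = - f J"
    and "J ! p = J ! q \<Longrightarrow> f J = 0"
  using assms unfolding alternating_def by blast+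

text \<open>
  A function of \<open>l\<close> and \<open>J\<close> is a tensor with one auxiliary factor and the factors numbered by the
  positions of \<open>J\<close>; \<open>exchange k\<close> is the permutation operator of the auxiliary factor and factor \<open>k\<close>.
\<close>
definition exchange :: "nat \<Rightarrow> ('n \<Rightarrow> 'n list \<Rightarrow> 'a) \<Rightarrow> 'n \<Rightarrow> 'n list \<Rightarrow> 'a" where
  "exchange k \<psi> l J = \<psi> (J ! k) (J[k := l])"

text \<open>
  Composing the transpositions \<open>(0 p)\<close> and \<open>(0 q)\<close> gives \<open>(0 q)\<close> composed with \<open>(p q)\<close>, and the
  latter acts on an alternating function by its sign.
\<close>
lemma exchange_exchange:
  assumes alt: "\<And>l. alternating N (\<psi> l)"
    and J: "length J = N" and pq: "p < N" "q < N" "p \<noteq> q"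
  shows "exchange p (exchange q \<psi>) l J = - exchange q \<psi> l J"
proof -
  have "exchange p (exchange q \<psi>) l J = \<psi> (J ! q) (J[p := l, q := J ! p])"
    using pq by (simp add: exchange_def)
  also have "J[p := l, q := J ! p] = (J[q := l])[p := (J[q := l]) ! q, q := (J[q := l]) ! p]"
    using J pq by (auto simp: list_eq_iff_nth_eq nth_list_update)
  also have "\<psi> (J ! q) \<dots> = - \<psi> (J ! q) (J[q := l])"
    by (rule alternatingD(1)[OF alt]) (use J pq in auto)
  finally show ?thesis by (simp add: exchange_def)
qed

text \<open>
  The difference of the two sides is, up to a factor, the antisymmetrization over one factor more
  than the dimension, hence zero.  Concretely: if \<open>J\<close> is a permutation of the basis, only the position
  \<open>k\<close> with \<open>J ! k = l\<close> leaves no repetition; if \<open>J\<close> has a repetition at \<open>p\<close> and \<open>q\<close>, only these two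
  positions contribute, with opposite signs.
\<close>
lemma sum_exchange:
  fixes \<psi> :: "'n::finite \<Rightarrow> 'n list \<Rightarrow> 'a::ring_1"
  assumes alt: "\<And>l. alternating CARD('n) (\<psi> l)" and J: "length J = CARD('n)"
  shows "(\<Sum>k<CARD('n). exchange k \<psi> l J) = \<psi> l J"
proof (cases "distinct J")
  case True
  then have "set J = UNIV"
    by (metis J card_subset_eq distinct_card finite_class.finite_UNIV subset_UNIV)
  then obtain b where b: "b < CARD('n)" "J ! b = l"
    using J by (metis UNIV_I in_set_conv_nth)
  have "exchange k \<psi> l J = 0" if "k < CARD('n)" "k \<noteq> b" for k
    unfolding exchange_def
    by (rule alternatingD(2)[OF alt, where p = k and q = b]) (use that b J in auto)
  then have "(\<Sum>k<CARD('n). exchange k \<psi> l J) = (\<Sum>k<CARD('n). if k = b then exchange b \<psi> l J else 0)"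
    by (intro sum.cong) auto
  also have "\<dots> = exchange b \<psi> l J" using b by simp
  also have "\<dots> = \<psi> l J" using b by (auto simp: exchange_def)
  finally show ?thesis .
next
  case False
  then obtain p q where pq: "p < CARD('n)" "q < CARD('n)" "p \<noteq> q" "J ! p = J ! q"
    using J by (auto simp: distinct_conv_nth)
  have "exchange k \<psi> l J = 0" if "k < CARD('n)" "k \<noteq> p" "k \<noteq> q" for k
    unfolding exchange_def
    by (rule alternatingD(2)[OF alt, where p = p and q = q]) (use that pq J in auto)
  then have "(\<Sum>k<CARD('n). exchange k \<psi> l J) = (\<Sum>k\<in>{p, q}. exchange k \<psi> l J)"
    using pq by (intro sum.mono_neutral_right) auto
  also have "\<dots> = exchange p \<psi> l J + exchange q \<psi> l J" using pq by simp
  also have "exchange p \<psi> l J = \<psi> (J ! q) (J[p := l])"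
    using pq by (simp add: exchange_def)
  also have "J[p := l] = (J[q := l])[p := (J[q := l]) ! q, q := (J[q := l]) ! p]"
    using J pq by (auto simp: list_eq_iff_nth_eq nth_list_update)
  also have "\<psi> (J ! q) \<dots> = - exchange q \<psi> l J"
    unfolding exchange_def by (rule alternatingD(1)[OF alt]) (use J pq in auto)
  finally have "(\<Sum>k<CARD('n). exchange k \<psi> l J) = 0" by simp
  moreover have "\<psi> l J = 0" by (rule alternatingD(2)[OF alt J pq])
  ultimately show ?thesis by simp
qed

lemma finite_multi_indices [simp]: "finite (multi_indices N :: 'n::finite list set)"
  using finite_lists_length_eq[of "UNIV :: 'n set" N] by (simp add: multi_indices_def)

text \<open>The pairing transposes operators on the row indices; exchange operators are self-adjoint.\<close>
definition pairing :: "nat \<Rightarrow> ('n \<Rightarrow> 'n list \<Rightarrow> 'a::ring_1) \<Rightarrow> ('n \<Rightarrow> 'n list \<Rightarrow> 'a) \<Rightarrow> 'a" where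
  "pairing N \<psi> \<phi> = (\<Sum>(i, I)\<in>UNIV \<times> multi_indices N. \<psi> i I * \<phi> i I)"

lemma pairing_exchange:
  assumes "k < N"
  shows "pairing N (exchange k \<psi>) \<phi> = pairing N \<psi> (exchange k \<phi>)"
  unfolding pairing_def
  by (rule sum.reindex_bij_witness[where i = "\<lambda>(i, I). (I ! k, I[k := i])" and j = "\<lambda>(i, I). (I ! k, I[k := i])"])
     (use assms in \<open>auto simp: exchange_def multi_indices_def\<close>)

section \<open>A chain of R-matrices on alternating functions\<close>

text \<open>
  Here \<open>x\<close> stands for \<open>u - z\<close>, and \<open>shift k\<close> for \<open>u - (z - k h)\<close>, the argument of the \<open>R\<close>-matrix
  that acts on the auxiliary factor and on factor \<open>k\<close>.
\<close>
locale R_chain =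
  fixes x h :: "'a::ring_1"
  assumes x_central: "x * y = y * x" and h_central: "h * y = y * h"
begin

definition shift :: "nat \<Rightarrow> 'a" where
  "shift k = x + of_nat k * h"

lemma shift_central: "shift k * y = y * shift k"
proof -
  have "of_nat k * h * y = y * (of_nat k * h)"
    by (metis h_central mult.assoc mult_of_nat_commute)
  then show ?thesis by (simp add: shift_def algebra_simps x_central)
qed

lemma shift_Suc: "shift (Suc k) = shift k + h"
  by (simp add: shift_def algebra_simps)

definition R_op :: "nat \<Rightarrow> ('n \<Rightarrow> 'n list \<Rightarrow> 'a) \<Rightarrow> 'n \<Rightarrow> 'n list \<Rightarrow> 'a" where
  "R_op k \<psi> = (\<lambda>l J. shift k * \<psi> l J - h * exchange k \<psi> l J)"

text \<open>
  The product \<open>R\<^sub>0 R\<^sub>1 \<dots>\<close> in which the operator with the largest number acts first.  The order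
  matters: in the reverse order the chain is in general not a scalar on alternating functions.
\<close>
primrec R_chain_op :: "nat \<Rightarrow> ('n \<Rightarrow> 'n list \<Rightarrow> 'a) \<Rightarrow> 'n \<Rightarrow> 'n list \<Rightarrow> 'a" where
  "R_chain_op 0 \<psi> = \<psi>"
| "R_chain_op (Suc j) \<psi> = R_chain_op j (R_op j \<psi>)"

lemma R_op_cong:
  assumes "\<And>l J. length J = N \<Longrightarrow> \<psi> l J = \<phi> l J" "length J = N"
  shows "R_op k \<psi> l J = R_op k \<phi> l J"
  using assms by (simp add: R_op_def exchange_def)

lemma R_chain_op_cong:
  assumes "\<And>l J. length J = N \<Longrightarrow> \<psi> l J = \<phi> l J" "length J = N"
  shows "R_chain_op k \<psi> l J = R_chain_op k \<phi> l J"
  using assms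
proof (induction k arbitrary: \<psi> \<phi>)
  case (Suc k)
  show ?case
    unfolding R_chain_op.simps by (rule Suc.IH) (use R_op_cong[of N \<psi> \<phi>] Suc.prems in blast)+
qed simp

lemma R_op_scale:
  assumes c: "\<And>y. c * y = y * c"
  shows "R_op k (\<lambda>l J. c * \<psi> l J) = (\<lambda>l J. c * R_op k \<psi> l J)"
proof -
  have "shift k * (c * z) = c * (shift k * z)" "h * (c * z) = c * (h * z)" for z
    by (metis c mult.assoc)+
  then show ?thesis by (simp add: R_op_def exchange_def right_diff_distrib)
qed

lemma R_chain_op_scale:
  assumes c: "\<And>y. c * y = y * c"
  shows "R_chain_op k (\<lambda>l J. c * \<psi> l J) = (\<lambda>l J. c * R_chain_op k \<psi> l J)"
  by (induction k arbitrary: \<psi>) (simp_all add: R_op_scale[OF c])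

primrec shift_prod :: "nat \<Rightarrow> 'a" where
  "shift_prod 0 = 1"
| "shift_prod (Suc k) = shift (Suc k) * shift_prod k"

text \<open>
  Applied to \<open>shift N\<close> times an alternating function, the operators with numbers \<open>N - 1, \<dots>, k\<close>
  produce the argument of the left-hand side, up to a scalar: by \<open>exchange_exchange\<close> the products of two
  exchanges that arise in each step are single exchanges again.  The identity records what the
  remaining \<open>k\<close> operators do to it; each induction step applies one of them.
\<close>
lemma R_chain_op_partial:
  assumes alt: "\<And>l. alternating N (\<psi> l)" and J: "length J = N" and k: "k \<le> N"
  shows "R_chain_op k (\<lambda>l J. shift k * \<psi> l J - h * (\<Sum>p = k..<N. exchange p \<psi> l J)) l J
       = shift_prod k * (x * \<psi> l J - h * (\<Sum>p<N. exchange p \<psi> l J))"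
  using J k
proof (induction k arbitrary: l J)
  case 0
  then show ?case by (simp add: shift_def atLeast0LessThan)
next
  case (Suc k)
  let ?\<phi> = "\<lambda>k l J. shift k * \<psi> l J - h * (\<Sum>p = k..<N. exchange p \<psi> l J)"
  have step: "R_op k (?\<phi> (Suc k)) l J = shift (Suc k) * ?\<phi> k l J" if "length J = N" for l J
  proof -
    define S where "S = (\<Sum>p = Suc k..<N. exchange p \<psi> l J)"
    have "exchange k (\<lambda>l J. \<Sum>p = Suc k..<N. exchange p \<psi> l J) l J = - S"
    proof -
      have "exchange k (\<lambda>l J. \<Sum>p = Suc k..<N. exchange p \<psi> l J) l J
          = (\<Sum>p = Suc k..<N. exchange k (exchange p \<psi>) l J)"
        by (simp add: exchange_def)
      also have "\<dots> = (\<Sum>p = Suc k..<N. - exchange p \<psi> l J)"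
        using Suc.prems that by (intro sum.cong refl exchange_exchange[OF alt]) auto
      finally show ?thesis by (simp add: S_def sum_negf)
    qed
    then have ex: "exchange k (?\<phi> (Suc k)) l J = shift (Suc k) * exchange k \<psi> l J + h * S"
      by (simp add: exchange_def)
    have sum: "(\<Sum>p = k..<N. exchange p \<psi> l J) = exchange k \<psi> l J + S"
      using Suc.prems by (simp add: S_def sum.atLeast_Suc_lessThan)
    have hs: "h * (shift (Suc k) * y) = shift (Suc k) * (h * y)" for y
      by (metis h_central mult.assoc)
    have ss: "shift k * (shift (Suc k) * y) = shift (Suc k) * (shift k * y)" for y
      by (metis shift_central mult.assoc)
    \<comment> \<open>The quadratic term \<open>h * (h * S)\<close> of the product is what turns \<open>shift k\<close> into \<open>shift (Suc k)\<close>.\<close>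
    have hk: "shift k * (h * S) = shift (Suc k) * (h * S) - h * (h * S)"
      by (simp add: shift_Suc algebra_simps)
    show ?thesis
      unfolding R_op_def ex sum S_def[symmetric]
      by (simp add: right_diff_distrib distrib_left hs ss hk)
  qed
  have "R_chain_op (Suc k) (?\<phi> (Suc k)) l J = R_chain_op k (\<lambda>l J. shift (Suc k) * ?\<phi> k l J) l J"
    unfolding R_chain_op.simps by (rule R_chain_op_cong[of N]) (use step Suc.prems in auto)
  also have "\<dots> = shift (Suc k) * R_chain_op k (?\<phi> k) l J"
    by (simp only: R_chain_op_scale[OF shift_central])
  also have "\<dots> = shift_prod (Suc k) * (x * \<psi> l J - h * (\<Sum>p<N. exchange p \<psi> l J))"
    using Suc by (simp add: mult.assoc)
  finally show ?case .
qed

text \<open>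
  The case \<open>k = N\<close> of the previous lemma, where the sum of exchanges is evaluated by
  \<open>sum_exchange\<close>.  The factor \<open>shift N\<close> is the one that the downward recursion starts from; it
  is cancelled with the others.
\<close>
lemma R_chain_op_alternating:
  fixes \<psi> :: "'n::finite \<Rightarrow> 'n list \<Rightarrow> 'a"
  assumes alt: "\<And>l. alternating CARD('n) (\<psi> l)" and J: "length J = CARD('n)"
  shows "shift CARD('n) * R_chain_op CARD('n) \<psi> l J = shift_prod CARD('n) * ((x - h) * \<psi> l J)"
proof -
  have "shift CARD('n) * R_chain_op CARD('n) \<psi> l J = R_chain_op CARD('n) (\<lambda>l J. shift CARD('n) * \<psi> l J) l J"
    by (simp only: R_chain_op_scale[OF shift_central])
  also have "\<dots> = shift_prod CARD('n) * (x * \<psi> l J - h * (\<Sum>p<CARD('n). exchange p \<psi> l J))"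
    using R_chain_op_partial[of "CARD('n)" \<psi> J "CARD('n)" l] alt J by simp
  also have "\<dots> = shift_prod CARD('n) * ((x - h) * \<psi> l J)"
    by (simp add: sum_exchange[OF alt J] algebra_simps)
  finally show ?thesis .
qed

lemma pairing_R_op:
  assumes "k < N"
  shows "pairing N (R_op k \<psi>) \<phi> = pairing N \<psi> (R_op k \<phi>)"
proof -
  have "pairing N (R_op k \<psi>) \<phi> = shift k * pairing N \<psi> \<phi> - h * pairing N (exchange k \<psi>) \<phi>"
    by (simp add: pairing_def R_op_def sum_distrib_left sum_subtractf[symmetric] algebra_simps case_prod_beta)
  moreover have "pairing N \<psi> (R_op k \<phi>) = shift k * pairing N \<psi> \<phi> - h * pairing N \<psi> (exchange k \<phi>)"
  proof -
    have "\<psi> i I * (shift k * z) = shift k * (\<psi> i I * z)" "\<psi> i I * (h * z) = h * (\<psi> i I * z)" for i I z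
      by (metis shift_central mult.assoc, metis h_central mult.assoc)
    then show ?thesis
      by (simp add: pairing_def R_op_def sum_distrib_left sum_subtractf[symmetric] right_diff_distrib case_prod_beta)
  qed
  ultimately show ?thesis using pairing_exchange[OF assms] by metis
qed

end

section \<open>Moving an entry through a product of matrices\<close>

text \<open>
  The relation between \<open>a = \<L>(u)\<close> and \<open>m k = \<L>(z - k h)\<close>, entry by entry.
\<close>
locale RLL_product = R_chain x h for x h :: "'a::ring_1" +
  fixes a :: "'n::finite \<Rightarrow> 'n \<Rightarrow> 'a" and m :: "nat \<Rightarrow> 'n \<Rightarrow> 'n \<Rightarrow> 'a"
  assumes RLL: "shift k * (a i j * m k c l - m k c l * a i j) = h * (a c j * m k i l - m k c j * a i l)"
begin

definition factors :: "nat list \<Rightarrow> 'n list \<Rightarrow> 'n list \<Rightarrow> 'a" where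
  "factors ks I J = prod_list (map (\<lambda>k. m k (I ! k) (J ! k)) ks)"

text \<open>
  An entry of the product with the matrix \<open>a\<close> in the auxiliary factor; \<open>(i, I)\<close> are the row indices and
  \<open>(l, J)\<close> the column indices.
\<close>
definition inserted :: "nat \<Rightarrow> nat \<Rightarrow> 'n \<Rightarrow> 'n list \<Rightarrow> 'n \<Rightarrow> 'n list \<Rightarrow> 'a" where
  "inserted N k i I l J = factors [0..<k] I J * a i l * factors [k..<N] I J"

lemma factors_update:
  assumes "p \<notin> set ks"
  shows "factors ks (I[p := c]) J = factors ks I J" "factors ks I (J[p := c]) = factors ks I J"
  using assms unfolding factors_def
  by (auto intro!: arg_cong[where f = prod_list]) (metis nth_list_update_neq)+

text \<open>The defining relation for factor \<open>k\<close>, multiplied by the remaining factors on both sides.\<close>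
lemma inserted_move:
  assumes k: "k < N" and I: "length I = N" and J: "length J = N"
  shows "R_op k (\<lambda>i I. inserted N k i I l J) i I = R_op k (\<lambda>l J. inserted N (Suc k) i I l J) l J"
proof -
  define pre where "pre = factors [0..<k] I J"
  define post where "post = factors [Suc k..<N] I J"
  have split: "factors [k..<N] I J = m k (I ! k) (J ! k) * factors [Suc k..<N] I J"
    "factors [0..<Suc k] I J = factors [0..<k] I J * m k (I ! k) (J ! k)" for I J
    using k by (simp_all add: factors_def upt_conv_Cons)
  have kk: "k \<notin> set [0..<k]" "k \<notin> set [Suc k..<N]" by auto
  let ?M = "m k (I ! k) (J ! k)"
  have central: "pre * (shift k * z) = shift k * (pre * z)" "pre * (h * z) = h * (pre * z)" for z
    by (metis shift_central mult.assoc, metis h_central mult.assoc)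
  have "R_op k (\<lambda>i I. inserted N k i I l J) i I
      = shift k * (pre * a i l * (?M * post)) - h * (pre * a (I ! k) l * (m k i (J ! k) * post))"
    using k I by (simp add: R_op_def exchange_def inserted_def split factors_update[OF kk(1)]
        factors_update[OF kk(2)] pre_def post_def mult.assoc)
  also have "\<dots> = pre * (shift k * (a i l * ?M) - h * (a (I ! k) l * m k i (J ! k))) * post"
    by (simp add: left_diff_distrib right_diff_distrib mult.assoc central)
  also have "shift k * (a i l * ?M) - h * (a (I ! k) l * m k i (J ! k))
      = shift k * (?M * a i l) - h * (m k (I ! k) l * a i (J ! k))"
    using RLL[of k i l "I ! k" "J ! k"] by (simp add: algebra_simps)
  also have "pre * \<dots> * post = R_op k (\<lambda>l J. inserted N (Suc k) i I l J) l J"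
    using k J by (simp add: R_op_def exchange_def inserted_def split factors_update[OF kk(1)]
        factors_update[OF kk(2)] pre_def[symmetric] post_def[symmetric]
        central left_diff_distrib right_diff_distrib mult.assoc del: upt_Suc)
  finally show ?thesis .
qed

text \<open>
  Row operators and column operators commute, so the relations for the factors \<open>0, \<dots>, k - 1\<close> can be
  applied one after the other.  The row operators move to \<open>\<psi>\<close> by transposition, which reverses
  their order; on the columns each new operator is applied before the earlier ones.  Thus the
  same chain appears on both sides.
\<close>
lemma pairing_chain:
  assumes "k \<le> N" "length J = N"
  shows "pairing N (R_chain_op k \<psi>) (\<lambda>i I. inserted N 0 i I l J)
    = R_chain_op k (\<lambda>l J. pairing N \<psi> (\<lambda>i I. inserted N k i I l J)) l J"
  using assms
proof (induction k arbitrary: \<psi> l J)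
  case 0
  then show ?case by simp
next
  case (Suc k)
  have k: "k < N" using Suc.prems by simp
  have "pairing N (R_chain_op (Suc k) \<psi>) (\<lambda>i I. inserted N 0 i I l J)
      = R_chain_op k (\<lambda>l J. pairing N (R_op k \<psi>) (\<lambda>i I. inserted N k i I l J)) l J"
    using Suc by simp
  also have "\<dots> = R_chain_op k (R_op k (\<lambda>l J. pairing N \<psi> (\<lambda>i I. inserted N (Suc k) i I l J))) l J"
  proof (rule R_chain_op_cong[OF _ Suc.prems(2)])
    fix l and J :: "'n list" assume J: "length J = N"
    have "pairing N (R_op k \<psi>) (\<lambda>i I. inserted N k i I l J)
        = pairing N \<psi> (\<lambda>i I. R_op k (\<lambda>l J. inserted N (Suc k) i I l J) l J)"
      unfolding pairing_R_op[OF k] unfolding pairing_def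
      by (intro sum.cong refl, clarify) (subst inserted_move[OF k _ J], auto simp: multi_indices_def)
    also have "\<dots> = R_op k (\<lambda>l J. pairing N \<psi> (\<lambda>i I. inserted N (Suc k) i I l J)) l J"
    proof -
      have "\<psi> i I * (shift k * z) = shift k * (\<psi> i I * z)" "\<psi> i I * (h * z) = h * (\<psi> i I * z)" for i I z
        by (metis shift_central mult.assoc, metis h_central mult.assoc)
      then show ?thesis
        by (simp add: pairing_def R_op_def exchange_def sum_distrib_left sum_subtractf[symmetric] right_diff_distrib case_prod_beta)
    qed
    finally show "pairing N (R_op k \<psi>) (\<lambda>i I. inserted N k i I l J)
       = R_op k (\<lambda>l J. pairing N \<psi> (\<lambda>i I. inserted N (Suc k) i I l J)) l J" .
  qed
  finally show ?case by simp
qed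

definition minor :: "('n list \<Rightarrow> 'a) \<Rightarrow> 'n list \<Rightarrow> 'a" where
  "minor \<epsilon> J = (\<Sum>I\<in>multi_indices CARD('n). \<epsilon> I * factors [0..<CARD('n)] I J)"

text \<open>
  Take for the row function the tensor product of the basis vector \<open>i\<close> and \<open>\<epsilon>\<close>.  The chain is a scalar
  both on this function and on the column function \<open>(l, J) \<mapsto> minor \<epsilon> J * a i l\<close>, as both are
  alternating in their lists.
\<close>
lemma minor_commute_scaled:
  assumes alt: "alternating CARD('n) \<epsilon>" and alt': "alternating CARD('n) (minor \<epsilon>)"
    and \<epsilon>: "\<And>I y. \<epsilon> I * y = y * \<epsilon> I" and J: "length J = CARD('n)"
  shows "shift_prod CARD('n) * ((x - h) * (a i l * minor \<epsilon> J - minor \<epsilon> J * a i l)) = 0"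
proof -
  let ?N = "CARD('n)"
  define \<psi> where "\<psi> = (\<lambda>i' I. if i' = i then \<epsilon> I else 0)"
  have pair: "pairing ?N \<psi> \<phi> = (\<Sum>I\<in>multi_indices ?N. \<epsilon> I * \<phi> i I)" for \<phi>
  proof -
    have "pairing ?N \<psi> \<phi> = (\<Sum>i'\<in>UNIV. \<Sum>I\<in>multi_indices ?N. \<psi> i' I * \<phi> i' I)"
      by (simp add: pairing_def sum.cartesian_product)
    also have "\<dots> = (\<Sum>i'\<in>UNIV. if i' = i then \<Sum>I\<in>multi_indices ?N. \<epsilon> I * \<phi> i I else 0)"
      by (intro sum.cong refl) (simp add: \<psi>_def)
    finally show ?thesis by simp
  qed
  have \<psi>: "alternating ?N (\<psi> i')" for i'
    using alt by (auto simp: alternating_def \<psi>_def)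
  have c: "shift_prod ?N * ((x - h) * y) * z = shift_prod ?N * ((x - h) * (y * z))" for y z
    by (simp add: mult.assoc)
  have "shift ?N * pairing ?N (R_chain_op ?N \<psi>) (\<lambda>i I. inserted ?N 0 i I l J)
     = (\<Sum>(i', I)\<in>UNIV \<times> multi_indices ?N. shift ?N * R_chain_op ?N \<psi> i' I * inserted ?N 0 i' I l J)"
    by (simp add: pairing_def sum_distrib_left mult.assoc case_prod_beta)
  also have "\<dots> = shift_prod ?N * ((x - h) * pairing ?N \<psi> (\<lambda>i I. inserted ?N 0 i I l J))"
    unfolding pairing_def sum_distrib_left
    by (intro sum.cong refl) (auto simp: c multi_indices_def R_chain_op_alternating[OF \<psi>])
  also have "pairing ?N \<psi> (\<lambda>i I. inserted ?N 0 i I l J) = a i l * minor \<epsilon> J"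
  proof -
    have "\<epsilon> I * (a i l * y) = a i l * (\<epsilon> I * y)" for I y by (metis \<epsilon> mult.assoc)
    then show ?thesis
      by (simp add: pair inserted_def minor_def sum_distrib_left factors_def)
  qed
  finally have 1: "shift ?N * pairing ?N (R_chain_op ?N \<psi>) (\<lambda>i I. inserted ?N 0 i I l J)
     = shift_prod ?N * ((x - h) * (a i l * minor \<epsilon> J))" .
  have "pairing ?N (R_chain_op ?N \<psi>) (\<lambda>i I. inserted ?N 0 i I l J)
     = R_chain_op ?N (\<lambda>l J. pairing ?N \<psi> (\<lambda>i I. inserted ?N ?N i I l J)) l J"
    using J by (intro pairing_chain) auto
  also have "(\<lambda>l J. pairing ?N \<psi> (\<lambda>i I. inserted ?N ?N i I l J)) = (\<lambda>l J. minor \<epsilon> J * a i l)"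
    by (simp add: pair inserted_def minor_def sum_distrib_right factors_def mult.assoc)
  finally have "shift ?N * pairing ?N (R_chain_op ?N \<psi>) (\<lambda>i I. inserted ?N 0 i I l J)
     = shift_prod ?N * ((x - h) * (minor \<epsilon> J * a i l))"
    using R_chain_op_alternating[of "\<lambda>l J. minor \<epsilon> J * a i l" J l] alt' J
    by (simp add: alternating_def)
  with 1 show ?thesis by (simp add: right_diff_distrib)
qed

end

section \<open>Minors are alternating in the columns\<close>

text \<open>
  The transposition of \<open>p\<close> and \<open>q + 1\<close> is the transposition of \<open>p\<close> and \<open>q\<close>, conjugated by an adjacent one.
\<close>
lemma adjacent_swaps_imp_swap:
  fixes f :: "'n list \<Rightarrow> 'a::ring_1"
  assumes adj: "\<And>J k. length J = N \<Longrightarrow> Suc k < N \<Longrightarrow> f (J[k := J ! Suc k, Suc k := J ! k]) = - f J"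
    and J: "length J = N" and pq: "p < q" "q < N"
  shows "f (J[p := J ! q, q := J ! p]) = - f J"
  using pq J
proof (induction q arbitrary: J)
  case 0
  then show ?case by simp
next
  case (Suc q)
  show ?case
  proof (cases "p = q")
    case True
    then show ?thesis using adj Suc.prems by auto
  next
    case False
    define K where "K = J[q := J ! Suc q, Suc q := J ! q]"
    define K' where "K' = K[p := K ! q, q := K ! p]"
    have len: "length K = N" "length K' = N" using Suc.prems by (simp_all add: K_def K'_def)
    have "J[p := J ! Suc q, Suc q := J ! p] = K'[q := K' ! Suc q, Suc q := K' ! q]"
      using Suc.prems False by (auto simp: K_def K'_def list_eq_iff_nth_eq nth_list_update)
    also have "f \<dots> = - f K'" using Suc.prems by (intro adj len) auto
    also have "f K' = - f K" unfolding K'_def using Suc.prems False by (intro Suc.IH len) auto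
    also have "f K = - f J" unfolding K_def using Suc.prems by (intro adj) auto
    finally show ?thesis by simp
  qed
qed

lemma alternatingI:
  fixes f :: "'n list \<Rightarrow> 'a::ring_1"
  assumes half: "\<And>y::'a. y + y = 0 \<Longrightarrow> y = 0"
    and adj: "\<And>J k. length J = N \<Longrightarrow> Suc k < N \<Longrightarrow> f (J[k := J ! Suc k, Suc k := J ! k]) = - f J"
  shows "alternating N f"
  unfolding alternating_def
proof (intro allI impI conjI)
  fix J :: "'n list" and p q
  assume J: "length J = N" and pq: "p < N" "q < N" "p \<noteq> q"
  show swap: "f (J[p := J ! q, q := J ! p]) = - f J"
  proof (cases "p < q")
    case True
    then show ?thesis using adjacent_swaps_imp_swap[of N f, OF adj J] pq by blast
  next
    case False
    then have "f (J[q := J ! p, p := J ! q]) = - f J"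
      using adjacent_swaps_imp_swap[of N f, OF adj J] pq by (meson linorder_neqE_nat)
    then show ?thesis using pq by (simp add: list_update_swap)
  qed
  assume "J ! p = J ! q"
  then have "J[p := J ! q, q := J ! p] = J" by (metis list_update_id)
  with swap show "f J = 0" using half[of "f J"] by (metis add.right_inverse)
qed

context RLL_product begin

text \<open>
  It suffices to swap the columns of two adjacent factors.  As \<open>\<epsilon>\<close> is alternating, twice the minor is a
  sum over the differences of a product and the product with these two rows swapped, and the
  fused relation says that such a difference changes sign with the columns.
\<close>
lemma alternating_minor:
  assumes half: "\<And>y::'a. y + y = 0 \<Longrightarrow> y = 0"
    and fused: "\<And>k i j c l. m k i j * m (Suc k) c l - m k c j * m (Suc k) i l
          = - (m k i l * m (Suc k) c j - m k c l * m (Suc k) i j)"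
    and alt: "alternating CARD('n) \<epsilon>"
  shows "alternating CARD('n) (minor \<epsilon>)"
proof (rule alternatingI[OF half])
  let ?N = "CARD('n)"
  fix J :: "'n list" and k
  assume J: "length J = ?N" and k: "Suc k < ?N"
  define s :: "'n list \<Rightarrow> 'n list" where "s I = I[k := I ! Suc k, Suc k := I ! k]" for I
  let ?F = "factors [0..<?N]"
  define pre where "pre I J = factors [0..<k] I J" for I J
  define post where "post I J = factors [Suc (Suc k)..<?N] I J" for I J
  have "[0..<?N] = [0..<k] @ [k, Suc k] @ [Suc (Suc k)..<?N]"
    using k by (metis (no_types) Suc_lessD append_Cons append_Nil le_add_same_cancel1 less_imp_le
       upt_add_eq_append upt_conv_Cons zero_le ordered_cancel_comm_monoid_diff_class.add_diff_inverse)
  then have F: "?F I J = pre I J * (m k (I ! k) (J ! k) * m (Suc k) (I ! Suc k) (J ! Suc k)) * post I J" for I J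
    by (simp add: factors_def pre_def post_def mult.assoc)
  have s: "pre (s I) J = pre I J" "post (s I) J = post I J" "pre I (s J) = pre I J" "post I (s J) = post I J" for I J
    unfolding pre_def post_def s_def by (simp_all add: factors_update)
  have nth_s: "s I ! k = I ! Suc k" "s I ! Suc k = I ! k" if "length I = ?N" for I
    using that k by (simp_all add: s_def)
  have s_s: "s (s I) = I" "length (s I) = ?N" if "length I = ?N" for I
    using that k by (auto simp: s_def list_eq_iff_nth_eq nth_list_update)
  have double: "minor \<epsilon> J + minor \<epsilon> J = (\<Sum>I\<in>multi_indices ?N. \<epsilon> I * (?F I J - ?F (s I) J))" for J
  proof -
    have "minor \<epsilon> J = (\<Sum>I\<in>multi_indices ?N. \<epsilon> (s I) * ?F (s I) J)"
      unfolding minor_def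
      by (rule sum.reindex_bij_witness[where i = s and j = s])
         (auto simp: multi_indices_def s_s)
    also have "\<dots> = (\<Sum>I\<in>multi_indices ?N. - (\<epsilon> I * ?F (s I) J))"
      by (intro sum.cong refl)
         (use k alternatingD(1)[OF alt, of _ k "Suc k"] in \<open>auto simp: s_def multi_indices_def\<close>)
    finally show ?thesis
      by (simp add: minor_def sum_negf sum_subtractf right_diff_distrib)
  qed
  have "?F I (s J) - ?F (s I) (s J) = - (?F I J - ?F (s I) J)" if "I \<in> multi_indices ?N" for I
  proof -
    have I: "length I = ?N" using that by (simp add: multi_indices_def)
    have "?F I (s J) - ?F (s I) (s J) = pre I J * (m k (I ! k) (J ! Suc k) * m (Suc k) (I ! Suc k) (J ! k)
        - m k (I ! Suc k) (J ! Suc k) * m (Suc k) (I ! k) (J ! k)) * post I J"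
      unfolding F s nth_s[OF I] nth_s[OF J] by (simp add: right_diff_distrib left_diff_distrib)
    also have "\<dots> = - (?F I J - ?F (s I) J)"
      unfolding F s nth_s[OF I] by (subst fused) (simp add: right_diff_distrib left_diff_distrib)
    finally show ?thesis .
  qed
  then have "minor \<epsilon> (s J) + minor \<epsilon> (s J) = - (minor \<epsilon> J + minor \<epsilon> J)"
    unfolding double sum_negf[symmetric] mult_minus_right[symmetric] by (intro sum.cong refl) simp
  then have "(minor \<epsilon> (s J) + minor \<epsilon> J) + (minor \<epsilon> (s J) + minor \<epsilon> J) = 0"
    by (simp add: algebra_simps eq_neg_iff_add_eq_0)
  from half[OF this] show "minor \<epsilon> (J[k := J ! Suc k, Suc k := J ! k]) = - minor \<epsilon> J"
    by (simp add: s_def eq_neg_iff_add_eq_0)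
qed

lemma minor_commute:
  assumes half: "\<And>y::'a. y + y = 0 \<Longrightarrow> y = 0"
    and cancel: "\<And>(c::int) y. (x + of_int c * h) * y = 0 \<Longrightarrow> y = 0"
    and fused: "\<And>k i j c l. m k i j * m (Suc k) c l - m k c j * m (Suc k) i l
          = - (m k i l * m (Suc k) c j - m k c l * m (Suc k) i j)"
    and alt: "alternating CARD('n) \<epsilon>" and \<epsilon>: "\<And>I y. \<epsilon> I * y = y * \<epsilon> I"
    and J: "length J = CARD('n)"
  shows "a i l * minor \<epsilon> J = minor \<epsilon> J * a i l"
proof -
  have "shift_prod k * y = 0 \<Longrightarrow> y = 0" for k y
  proof (induction k arbitrary: y)
    case (Suc k)
    then have "(x + of_int (int (Suc k)) * h) * (shift_prod k * y) = 0"
      by (simp only: shift_prod.simps shift_def mult.assoc of_int_of_nat_eq)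
    from cancel[OF this] show ?case by (rule Suc.IH)
  qed simp
  then have "(x + of_int (- 1) * h) * (a i l * minor \<epsilon> J - minor \<epsilon> J * a i l) = 0"
    using minor_commute_scaled[OF alt alternating_minor[OF half fused alt] \<epsilon> J, of i l] by simp
  from cancel[OF this] show ?thesis by simp
qed

end

section \<open>Laurent series bounded above and the fused relation\<close>

text \<open>
  Series in \<open>z\<close> with exponents at most \<open>p\<close> are Laurent series in \<open>z\<^sup>-\<^sup>1\<close>, so the coefficient of
  \<open>z\<^sup>n\<close> sits at \<open>- n\<close>, and \<open>fls_X_inv\<close> is \<open>z\<close>.
\<close>
definition top_fls :: "int \<Rightarrow> (int \<Rightarrow> 'a::zero) \<Rightarrow> 'a fls" where
  "top_fls p f = Abs_fls (\<lambda>n. if - n \<le> p then f (- n) else 0)"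

lemma top_fls_nth: "top_fls p f $$ n = (if - n \<le> p then f (- n) else 0)"
  unfolding top_fls_def by (rule nth_Abs_fls_lower_bound[of "- p"]) auto

lemma fls_times_nth_window:
  fixes f g :: "'a::semiring_0 fls"
  assumes f: "\<And>m. m < - p \<Longrightarrow> f $$ m = 0" and g: "\<And>m. m < - q \<Longrightarrow> g $$ m = 0"
    and W: "finite W" "{n - q..p} \<subseteq> W"
  shows "(f * g) $$ (- n) = (\<Sum>t\<in>W. f $$ (- t) * g $$ (- (n - t)))"
proof -
  have "(f * g) $$ (- n) = (\<Sum>i = fls_subdegree f..- n - fls_subdegree g. f $$ i * g $$ (- n - i))"
    by (rule fls_times_nth(2))
  also have "\<dots> = (\<Sum>i\<in>uminus ` W. f $$ i * g $$ (- n - i))"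
  proof (rule sum.mono_neutral_cong)
    fix i assume "i \<in> uminus ` W - {fls_subdegree f..- n - fls_subdegree g}"
    then show "f $$ i * g $$ (- n - i) = 0" by auto
  next
    fix i assume "i \<in> {fls_subdegree f..- n - fls_subdegree g} - uminus ` W"
    then have "- i \<notin> {n - q..p}" using W(2) by (metis DiffD2 image_eqI minus_minus subsetD)
    then show "f $$ i * g $$ (- n - i) = 0" using f[of i] g[of "- n - i"] by force
  qed (use W in auto)
  also have "\<dots> = (\<Sum>t\<in>W. f $$ (- t) * g $$ (- (n - t)))"
    by (subst sum.reindex) (auto simp: inj_on_def algebra_simps)
  finally show ?thesis .
qed

text \<open>
  The relations in \<open>Y / I\<^sub>p\<close>: \<open>l r i j\<close> is the coefficient of \<open>u\<^sup>r\<close> in entry \<open>(i, j)\<close> of \<open>\<L>(u)\<close>, and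
  \<open>sh k r n\<close> is the coefficient of \<open>z\<^sup>n\<close> in \<open>(z - k h)\<^sup>r\<close>, given by its
  vanishing for \<open>n > r\<close> and Pascal's rule.
\<close>
locale RLL_level =
  fixes p :: int and h :: "'a::ring_1" and l :: "int \<Rightarrow> 'n::finite \<Rightarrow> 'n \<Rightarrow> 'a"
    and sh :: "nat \<Rightarrow> int \<Rightarrow> int \<Rightarrow> 'a"
  assumes h_commute: "h * y = y * h"
    and half: "y + y = 0 \<Longrightarrow> y = (0 :: 'a)"
    and l_top: "r > p \<Longrightarrow> l r i j = 0"
    and sh_commute: "sh k r n * y = y * sh k r n"
    and sh_top: "n > r \<Longrightarrow> sh k r n = 0"
    and sh_Pascal: "sh k (r + 1) n = sh k r (n - 1) - of_nat k * h * sh k r n"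
    and RLL_coeff: "(l (a - 1) i j * l b c d - l b c d * l (a - 1) i j) - (l a i j * l (b - 1) c d - l (b - 1) c d * l a i j)
       = h * (l a c j * l b i d - l b c j * l a i d)"
begin

text \<open>
  For fixed indices let \<open>C(u, v)\<close> be the commutator of entry \<open>(i, j)\<close> of \<open>\<L>(u)\<close> and entry \<open>(c, d)\<close>
  of \<open>\<L>(v)\<close>, and \<open>D(u, v)\<close> the right-hand side of the relation \<open>(u - v) C = h D\<close>.  The
  following are the coefficients of \<open>u\<^sup>a v\<^sup>b\<close> in \<open>C\<close>, in \<open>D\<close> and in the quotient
  \<open>Q = D / (u - v)\<close>, expanded in powers of \<open>v / u\<close>.
\<close>
definition comm_coeff :: "'n \<Rightarrow> 'n \<Rightarrow> 'n \<Rightarrow> 'n \<Rightarrow> int \<Rightarrow> int \<Rightarrow> 'a" where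
  "comm_coeff i j c d a b = l a i j * l b c d - l b c d * l a i j"

definition exch_coeff :: "'n \<Rightarrow> 'n \<Rightarrow> 'n \<Rightarrow> 'n \<Rightarrow> int \<Rightarrow> int \<Rightarrow> 'a" where
  "exch_coeff i j c d a b = l a c j * l b i d - l b c j * l a i d"

definition quot_coeff :: "'n \<Rightarrow> 'n \<Rightarrow> 'n \<Rightarrow> 'n \<Rightarrow> int \<Rightarrow> int \<Rightarrow> 'a" where
  "quot_coeff i j c d a b = (\<Sum>t\<in>{a<..p}. exch_coeff i j c d t (a + b + 1 - t))"

lemma comm_coeff_step: "comm_coeff i j c d (a - 1) b = comm_coeff i j c d a (b - 1) + h * exch_coeff i j c d a b"
  using RLL_coeff[of a i j b c d] by (simp add: comm_coeff_def exch_coeff_def algebra_simps)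

lemma exch_coeff_quot: "exch_coeff i j c d a b = quot_coeff i j c d (a - 1) b - quot_coeff i j c d a (b - 1)"
proof (cases "a \<le> p")
  case True
  then have "{a - 1<..p} = insert a {a<..p}" by auto
  then show ?thesis by (simp add: quot_coeff_def algebra_simps)
next
  case False
  then show ?thesis by (simp add: quot_coeff_def exch_coeff_def l_top)
qed

text \<open>
  Cancelling \<open>u - v\<close> in \<open>(u - v) C = h (u - v) Q\<close>: the coefficients agree, as zeros, for \<open>a > p\<close>,
  and the coefficients for \<open>a\<close> determine those for \<open>a - 1\<close>.
\<close>
lemma comm_coeff_quot: "comm_coeff i j c d a b = h * quot_coeff i j c d a b"
proof (induction "nat (p + 1 - a)" arbitrary: a b)
  case 0
  then show ?case by (simp add: comm_coeff_def quot_coeff_def l_top)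
next
  case (Suc n)
  then have "n = nat (p + 1 - (a + 1))" by simp
  from Suc(1)[OF this, of "b - 1"]
  have "comm_coeff i j c d a b = h * (quot_coeff i j c d (a + 1) (b - 1) + exch_coeff i j c d (a + 1) b)"
    using comm_coeff_step[of i j c d "a + 1" b] by (simp add: distrib_left)
  then show ?case using exch_coeff_quot[of i j c d "a + 1" b] by simp
qed

text \<open>
  The expansion of \<open>Q\<close> makes it bounded in \<open>u\<close> only.  It is bounded in \<open>v\<close> since for \<open>b \<ge> p\<close> the
  defining sum runs over a whole antidiagonal of the coefficients of \<open>D\<close>, where it cancels by
  antisymmetry.
\<close>
lemma quot_coeff_top: "a \<ge> p \<or> b \<ge> p \<Longrightarrow> quot_coeff i j c d a b = 0"
proof (cases "a \<ge> p")
  case False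
  assume "a \<ge> p \<or> b \<ge> p"
  with False have b: "b \<ge> p" by simp
  define e where "e = a + b + 1"
  define S where "S = (\<Sum>t\<in>{e - p..p}. exch_coeff i j c d t (e - t))"
  have Z: "quot_coeff i j c d a b = S"
    unfolding quot_coeff_def S_def e_def[symmetric]
  proof (rule sum.mono_neutral_right)
    show "\<forall>t\<in>{a<..p} - {e - p..p}. exch_coeff i j c d t (e - t) = 0"
      by (auto simp: exch_coeff_def l_top)
  qed (use b in \<open>auto simp: e_def\<close>)
  have "S = (\<Sum>t\<in>{e - p..p}. exch_coeff i j c d (e - t) t)"
    unfolding S_def by (rule sum.reindex_bij_witness[where i = "\<lambda>t. e - t" and j = "\<lambda>t. e - t"]) auto
  also have "\<dots> = (\<Sum>t\<in>{e - p..p}. - exch_coeff i j c d t (e - t))"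
    by (simp add: exch_coeff_def)
  also have "\<dots> = - S" by (simp add: S_def sum_negf)
  finally have "S + S = 0" by (metis add.right_inverse)
  from half[OF this] show ?thesis using Z by simp
qed (simp add: quot_coeff_def)

text \<open>The series \<open>(z - k h)\<^sup>r\<close>.\<close>
definition zpow :: "nat \<Rightarrow> int \<Rightarrow> 'a fls" where
  "zpow k r = top_fls r (sh k r)"

lemma zpow_nth: "zpow k r $$ (- n) = sh k r n"
  by (simp add: zpow_def top_fls_nth sh_top)

lemma zpow_eq_0: "m < - r \<Longrightarrow> zpow k r $$ m = 0"
  using zpow_nth[of k r "- m"] by (simp add: sh_top)

lemma zpow_Suc: "zpow k (r + 1) = (fls_X_inv - fls_const (of_nat k * h)) * zpow k r"
proof (rule fls_eqI)
  fix m
  show "zpow k (r + 1) $$ m = ((fls_X_inv - fls_const (of_nat k * h)) * zpow k r) $$ m"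
    using zpow_nth[of k "r + 1" "- m"] zpow_nth[of k r "- m"] zpow_nth[of k r "- m - 1"] sh_Pascal[of k r "- m"]
    by (simp add: left_diff_distrib fls_X_inv_times_conv_shift add.commute)
qed

lemma zpow_central: "zpow k r * f = f * zpow k r"
proof (rule fls_eqI)
  fix m
  define q where "q = - fls_subdegree f"
  have f: "f $$ m = 0" if "m < - q" for m using that by (simp add: q_def)
  have "(zpow k r * f) $$ (- (- m)) = (\<Sum>t\<in>{- m - q..r}. zpow k r $$ (- t) * f $$ (- (- m - t)))"
    by (rule fls_times_nth_window[OF zpow_eq_0 f]) auto
  also have "\<dots> = (\<Sum>t\<in>{- m - r..q}. f $$ (- t) * zpow k r $$ (- (- m - t)))"
    by (rule sum.reindex_bij_witness[where i = "\<lambda>t. - m - t" and j = "\<lambda>t. - m - t"])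
       (auto simp: zpow_nth sh_commute)
  also have "\<dots> = (f * zpow k r) $$ (- (- m))"
    by (rule fls_times_nth_window[OF f zpow_eq_0, symmetric]) auto
  finally show "(zpow k r * f) $$ m = (f * zpow k r) $$ m" by simp
qed

text \<open>
  The coefficient of \<open>z\<^sup>n\<close> in \<open>u\<^sup>a v\<^sup>b\<close> at \<open>u = z - k h\<close>, \<open>v = z - (k + 1) h\<close>.  There
  \<open>u - v = h\<close>, which is \<open>zpow2_step\<close>.
\<close>
definition zpow2 :: "nat \<Rightarrow> int \<Rightarrow> int \<Rightarrow> int \<Rightarrow> 'a" where
  "zpow2 k n a b = (zpow k a * zpow (Suc k) b) $$ (- n)"

lemma zpow2_low: "a + b < n \<Longrightarrow> zpow2 k n a b = 0"
proof -
  assume "a + b < n"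
  then show ?thesis
    unfolding zpow2_def by (subst fls_times_nth_window[OF zpow_eq_0 zpow_eq_0, where W = "{n - b..a}"]) auto
qed

lemma zpow2_central: "zpow2 k n a b * y = y * zpow2 k n a b"
proof -
  have "zpow k a * zpow (Suc k) b * fls_const y = fls_const y * (zpow k a * zpow (Suc k) b)"
    by (metis mult.assoc zpow_central)
  then show ?thesis unfolding zpow2_def by (metis fls_mult_const_nth)
qed

lemma zpow2_step: "zpow2 k n (a + 1) b - zpow2 k n a (b + 1) = h * zpow2 k n a b"
proof -
  have "zpow k (a + 1) * zpow (Suc k) b - zpow k a * zpow (Suc k) (b + 1)
     = fls_X_inv * (zpow k a * zpow (Suc k) b) - fls_const (of_nat k * h) * (zpow k a * zpow (Suc k) b)
       - (zpow k a * fls_X_inv) * zpow (Suc k) b + (zpow k a * fls_const (of_nat (Suc k) * h)) * zpow (Suc k) b"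
    by (simp only: zpow_Suc left_diff_distrib right_diff_distrib mult.assoc) simp
  also have "zpow k a * fls_X_inv = fls_X_inv * zpow k a" by (rule zpow_central)
  also have "zpow k a * fls_const (of_nat (Suc k) * h) = fls_const (of_nat (Suc k) * h) * zpow k a"
    by (rule zpow_central)
  also have "fls_const (of_nat (Suc k) * h) = fls_const (of_nat k * h) + fls_const h"
    by (simp add: fls_plus_const algebra_simps)
  finally have "zpow k (a + 1) * zpow (Suc k) b - zpow k a * zpow (Suc k) (b + 1)
     = fls_const h * (zpow k a * zpow (Suc k) b)"
    by (simp add: distrib_right mult.assoc)
  then show ?thesis
    unfolding zpow2_def by (metis fls_minus_nth fls_mult_const_nth(1))
qed

text \<open>
  The substitution \<open>u = z - k h\<close>, \<open>v = z - (k + 1) h\<close> in \<open>C = h Q\<close> and \<open>D = (u - v) Q\<close> shows that \<open>C\<close>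
  and \<open>D\<close> take the same value.
\<close>
lemma zpow2_comm_exch:
  "(\<Sum>a\<in>{n - p..p}. \<Sum>b\<in>{n - p..p}. zpow2 k n a b * comm_coeff i j c d a b)
   = (\<Sum>a\<in>{n - p..p}. \<Sum>b\<in>{n - p..p}. zpow2 k n a b * exch_coeff i j c d a b)"
proof -
  \<comment> \<open>One step of room below, since multiplication by \<open>u - v\<close> shifts exponents.\<close>
  let ?W = "{n - p..p}" and ?V = "{n - p - 1..p}"
  let ?Z = "quot_coeff i j c d"
  have hE: "zpow2 k n a b * (h * z) = h * (zpow2 k n a b * z)" for a b z by (metis zpow2_central mult.assoc)
  have low: "zpow2 k n (a + 1) b * ?Z a b = 0" "zpow2 k n b (a + 1) * ?Z b a = 0" if "a \<le> p" "b < n - p" for a b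
    using that by (cases "a = p"; simp add: quot_coeff_top zpow2_low)+
  have "(\<Sum>(a, b)\<in>?W \<times> ?W. zpow2 k n a b * comm_coeff i j c d a b)
      = (\<Sum>(a, b)\<in>?V \<times> ?V. zpow2 k n a b * comm_coeff i j c d a b)"
  proof (rule sum.mono_neutral_left)
    show "\<forall>ab\<in>?V \<times> ?V - ?W \<times> ?W. (case ab of (a, b) \<Rightarrow> zpow2 k n a b * comm_coeff i j c d a b) = 0"
    proof
      fix ab assume "ab \<in> ?V \<times> ?V - ?W \<times> ?W"
      then have "fst ab + snd ab < n" by auto
      then show "(case ab of (a, b) \<Rightarrow> zpow2 k n a b * comm_coeff i j c d a b) = 0"
        by (simp add: zpow2_low case_prod_beta)
    qed
  qed auto
  also have "\<dots> = (\<Sum>(a, b)\<in>?V \<times> ?V. zpow2 k n (a + 1) b * ?Z a b) - (\<Sum>(a, b)\<in>?V \<times> ?V. zpow2 k n a (b + 1) * ?Z a b)"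
    by (simp add: comm_coeff_quot hE sum_subtractf[symmetric] case_prod_beta left_diff_distrib[symmetric] zpow2_step mult.assoc)
  also have "(\<Sum>(a, b)\<in>?V \<times> ?V. zpow2 k n (a + 1) b * ?Z a b) = (\<Sum>(a, b)\<in>?W \<times> ?W. zpow2 k n a b * ?Z (a - 1) b)"
    by (rule sum.reindex_bij_witness_not_neutral[where i = "\<lambda>(a, b). (a - 1, b)" and j = "\<lambda>(a, b). (a + 1, b)"
          and S' = "{ab \<in> ?V \<times> ?V. case ab of (a, b) \<Rightarrow> a \<ge> p \<or> b < n - p}" and T' = "{}"])
       (auto simp: quot_coeff_top low)
  also have "(\<Sum>(a, b)\<in>?V \<times> ?V. zpow2 k n a (b + 1) * ?Z a b) = (\<Sum>(a, b)\<in>?W \<times> ?W. zpow2 k n a b * ?Z a (b - 1))"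
    by (rule sum.reindex_bij_witness_not_neutral[where i = "\<lambda>(a, b). (a, b - 1)" and j = "\<lambda>(a, b). (a, b + 1)"
          and S' = "{ab \<in> ?V \<times> ?V. case ab of (a, b) \<Rightarrow> b \<ge> p \<or> a < n - p}" and T' = "{}"])
       (auto simp: quot_coeff_top low)
  also have "(\<Sum>(a, b)\<in>?W \<times> ?W. zpow2 k n a b * ?Z (a - 1) b) - (\<Sum>(a, b)\<in>?W \<times> ?W. zpow2 k n a b * ?Z a (b - 1))
     = (\<Sum>(a, b)\<in>?W \<times> ?W. zpow2 k n a b * exch_coeff i j c d a b)"
    by (simp add: exch_coeff_quot sum_subtractf[symmetric] case_prod_beta right_diff_distrib)
  finally show ?thesis by (simp add: sum.cartesian_product)
qed

text \<open>Entry \<open>(i, j)\<close> of \<open>\<L>(z - k h)\<close>.\<close>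
definition L :: "nat \<Rightarrow> 'n \<Rightarrow> 'n \<Rightarrow> 'a fls" where
  "L k i j = top_fls p (\<lambda>n. \<Sum>r\<in>{n..p}. sh k r n * l r i j)"

lemma L_nth:
  assumes "finite W" "{n..p} \<subseteq> W"
  shows "L k i j $$ (- n) = (\<Sum>r\<in>W. sh k r n * l r i j)"
proof -
  have "L k i j $$ (- n) = (\<Sum>r\<in>{n..p}. sh k r n * l r i j)"
    by (simp add: L_def top_fls_nth)
  also have "\<dots> = (\<Sum>r\<in>W. sh k r n * l r i j)"
    using assms by (intro sum.mono_neutral_left) (auto simp: sh_top l_top)
  finally show ?thesis .
qed

lemma L_top: "m < - p \<Longrightarrow> L k i j $$ m = 0"
  by (simp add: L_def top_fls_nth)

lemma L_times_nth:
  "(L k i j * L k' c d) $$ (- n)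
   = (\<Sum>a\<in>{n - p..p}. \<Sum>b\<in>{n - p..p}. (zpow k a * zpow k' b) $$ (- n) * (l a i j * l b c d))"
proof -
  let ?W = "{n - p..p}"
  have "(L k i j * L k' c d) $$ (- n) = (\<Sum>t\<in>?W. L k i j $$ (- t) * L k' c d $$ (- (n - t)))"
    by (rule fls_times_nth_window[OF L_top L_top]) auto
  also have "\<dots> = (\<Sum>t\<in>?W. (\<Sum>a\<in>?W. sh k a t * l a i j) * (\<Sum>b\<in>?W. sh k' b (n - t) * l b c d))"
    by (intro sum.cong refl arg_cong2[where f = "(*)"] L_nth) auto
  also have "\<dots> = (\<Sum>t\<in>?W. \<Sum>a\<in>?W. \<Sum>b\<in>?W. sh k a t * sh k' b (n - t) * (l a i j * l b c d))"
  proof -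
    have "sh k a t * l a i j * (sh k' b s * l b c d) = sh k a t * sh k' b s * (l a i j * l b c d)" for a b t s
      by (metis sh_commute mult.assoc)
    then show ?thesis by (simp add: sum_product)
  qed
  also have "\<dots> = (\<Sum>a\<in>?W. \<Sum>b\<in>?W. \<Sum>t\<in>?W. sh k a t * sh k' b (n - t) * (l a i j * l b c d))"
    by (subst sum.swap, intro sum.cong refl sum.swap)
  also have "\<dots> = (\<Sum>a\<in>?W. \<Sum>b\<in>?W. (zpow k a * zpow k' b) $$ (- n) * (l a i j * l b c d))"
  proof (intro sum.cong refl)
    fix a b assume ab: "a \<in> ?W" "b \<in> ?W"
    have "(zpow k a * zpow k' b) $$ (- n) = (\<Sum>t\<in>?W. zpow k a $$ (- t) * zpow k' b $$ (- (n - t)))"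
      by (rule fls_times_nth_window[OF zpow_eq_0 zpow_eq_0]) (use ab in auto)
    then show "(\<Sum>t\<in>?W. sh k a t * sh k' b (n - t) * (l a i j * l b c d))
        = (zpow k a * zpow k' b) $$ (- n) * (l a i j * l b c d)"
      by (simp only: zpow_nth sum_distrib_right)
  qed
  finally show ?thesis .
qed

lemma fused_exchange:
  "L k i j * L (Suc k) c d - L (Suc k) c d * L k i j = L k c j * L (Suc k) i d - L (Suc k) c j * L k i d"
proof (rule fls_eqI)
  fix m :: int
  define n where "n = - m"
  have m: "m = - n" by (simp add: n_def)
  let ?W = "{n - p..p}"
  have 1: "(L k i j * L (Suc k) c d) $$ (- n) = (\<Sum>a\<in>?W. \<Sum>b\<in>?W. zpow2 k n a b * (l a i j * l b c d))" for i j c d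
    by (simp only: L_times_nth zpow2_def)
  have 2: "(L (Suc k) c d * L k i j) $$ (- n) = (\<Sum>a\<in>?W. \<Sum>b\<in>?W. zpow2 k n a b * (l b c d * l a i j))" for i j c d
    unfolding L_times_nth zpow2_def by (subst sum.swap) (simp only: zpow_central[of "Suc k" _ "zpow k _"])
  show "(L k i j * L (Suc k) c d - L (Suc k) c d * L k i j) $$ m = (L k c j * L (Suc k) i d - L (Suc k) c j * L k i d) $$ m"
    using zpow2_comm_exch[of k n i j c d]
    by (simp add: m 1 2 comm_coeff_def exch_coeff_def right_diff_distrib sum_subtractf)
qed

text \<open>
  Collect the terms of \<open>fused_exchange\<close> by the order of the factors.  This equates the
  antisymmetrization in the rows of a product in one order with the antisymmetrization in the columns of
  a product in the other order, and the latter changes sign when the columns are exchanged.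
\<close>
lemma fused_antisymmetric:
  "L k i j * L (Suc k) c d - L k c j * L (Suc k) i d = - (L k i d * L (Suc k) c j - L k c d * L (Suc k) i j)"
proof -
  have 1: "L k i j * L (Suc k) c d - L k c j * L (Suc k) i d = L (Suc k) c d * L k i j - L (Suc k) c j * L k i d" for j d
    using fused_exchange[of k i j c d] by (simp add: algebra_simps)
  show ?thesis unfolding 1 by simp
qed

section \<open>The relations in two variables\<close>

text \<open>
  Series in \<open>u\<close> whose coefficients are series in \<open>z\<close>: the embedding \<open>fls_const\<close> of the latter makes
  a series in \<open>z\<close> constant in \<open>u\<close>.
\<close>
definition outer :: "'n \<Rightarrow> 'n \<Rightarrow> 'a fls fls" where
  "outer i j = top_fls p (\<lambda>n. fls_const (l n i j))"

lemma outer_nth: "outer i j $$ (- n) = fls_const (l n i j)"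
  by (simp add: outer_def top_fls_nth l_top)

definition u_minus_z :: "'a fls fls" where
  "u_minus_z = fls_X_inv - fls_const fls_X_inv"

definition h_series :: "'a fls fls" where
  "h_series = fls_const (fls_const h)"

text \<open>
  A common range of summation for the coefficients of \<open>z\<^sup>n\<close> and \<open>z\<^sup>n\<^sup>-\<^sup>1\<close> that both occur when
  \<open>u - z\<close> is multiplied out, with room for a shift of the summation index.
\<close>
lemma L_nth_window:
  "L k i j $$ (- n) = (\<Sum>r\<in>{n - 1..p + 1}. sh k r n * l r i j)"
  "L k i j $$ (- n + 1) = (\<Sum>r\<in>{n - 1..p + 1}. sh k r (n - 1) * l r i j)"
  using L_nth[of "{n - 1..p + 1}" n k i j] L_nth[of "{n - 1..p + 1}" "n - 1" k i j] by auto

lemma comm_coeff_top: "b \<ge> p \<Longrightarrow> comm_coeff i j c d a b = 0"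
  by (simp add: comm_coeff_quot quot_coeff_top)

lemma L_comm:
  "(fls_const (l a i j) * L k c d - L k c d * fls_const (l a i j)) $$ (- n)
    = (\<Sum>r\<in>{n - 1..p + 1}. sh k r n * comm_coeff i j c d a r)"
  "(fls_const (l a i j) * L k c d - L k c d * fls_const (l a i j)) $$ (- n + 1)
    = (\<Sum>r\<in>{n - 1..p + 1}. sh k r (n - 1) * comm_coeff i j c d a r)"
proof -
  have "l a i j * (sh k r m * z) = sh k r m * (l a i j * z)" for r m z
    by (metis sh_commute mult.assoc)
  then show "(fls_const (l a i j) * L k c d - L k c d * fls_const (l a i j)) $$ (- n)
    = (\<Sum>r\<in>{n - 1..p + 1}. sh k r n * comm_coeff i j c d a r)"
  "(fls_const (l a i j) * L k c d - L k c d * fls_const (l a i j)) $$ (- n + 1)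
    = (\<Sum>r\<in>{n - 1..p + 1}. sh k r (n - 1) * comm_coeff i j c d a r)"
    by (simp_all only: fls_minus_nth fls_mult_const_nth L_nth_window sum_distrib_left sum_distrib_right
        sum_subtractf[symmetric] comm_coeff_def right_diff_distrib mult.assoc)
qed

lemma L_exch:
  "(fls_const (l a c j) * L k i d - L k c j * fls_const (l a i d)) $$ (- n)
    = (\<Sum>r\<in>{n - 1..p + 1}. sh k r n * exch_coeff i j c d a r)"
proof -
  have "l a c j * (sh k r m * z) = sh k r m * (l a c j * z)" for r m z
    by (metis sh_commute mult.assoc)
  then show ?thesis
    by (simp only: fls_minus_nth fls_mult_const_nth L_nth_window sum_distrib_left sum_distrib_right
        sum_subtractf[symmetric] exch_coeff_def right_diff_distrib mult.assoc)
qed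

text \<open>
  Pascal's rule for \<open>(z - k h)\<^sup>r\<close>.  The term at the upper end \<open>r = p\<close> disappears because the
  commutator is \<open>h Q\<close>, with \<open>Q\<close> of degree less than \<open>p\<close> in \<open>v\<close>.
\<close>
lemma shifted_sum:
  "(\<Sum>r\<in>{n - 1..p + 1}. sh k r n * comm_coeff i j c d a (r - 1))
   = (\<Sum>r\<in>{n - 1..p + 1}. sh k r (n - 1) * comm_coeff i j c d a r)
     - of_nat k * h * (\<Sum>r\<in>{n - 1..p + 1}. sh k r n * comm_coeff i j c d a r)"
proof -
  let ?W = "{n - 1..p + 1}"
  have "(\<Sum>r\<in>?W. sh k r n * comm_coeff i j c d a (r - 1)) = (\<Sum>r\<in>?W. sh k (r + 1) n * comm_coeff i j c d a r)"
    by (rule sum.reindex_bij_witness_not_neutral[where i = "\<lambda>r. r + 1" and j = "\<lambda>r. r - 1"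
          and S' = "{r\<in>{n - 1}. r \<in> ?W}" and T' = "{r \<in> {p + 1}. r \<in> ?W}"])
       (auto simp: sh_top comm_coeff_top)
  also have "\<dots> = (\<Sum>r\<in>?W. sh k r (n - 1) * comm_coeff i j c d a r) - of_nat k * h * (\<Sum>r\<in>?W. sh k r n * comm_coeff i j c d a r)"
    by (simp add: sh_Pascal left_diff_distrib sum_subtractf sum_distrib_left mult.assoc)
  finally show ?thesis .
qed

text \<open>The defining relation with \<open>v = z - k h\<close>; the relation is linear in \<open>\<L>(v)\<close> and \<open>v \<L>(v)\<close>.\<close>
lemma RLL_series:
  "(u_minus_z + of_nat k * h_series) * (outer i j * fls_const (L k c d) - fls_const (L k c d) * outer i j)
    = h_series * (outer c j * fls_const (L k i d) - fls_const (L k c j) * outer i d)"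
proof (rule fls_eqI, rule fls_eqI)
  fix m m' :: int
  define a n where "a = - m" and "n = - m'"
  have m: "m = - a" "m' = - n" by (simp_all add: a_def n_def)
  let ?W = "{n - 1..p + 1}"
  let ?C = "\<lambda>a. fls_const (l a i j) * L k c d - L k c d * fls_const (l a i j)"
  have of_nat: "of_nat k * h_series = fls_const (fls_const (of_nat k * h))"
    by (simp add: h_series_def fls_of_nat)
  have "((u_minus_z + of_nat k * h_series) * (outer i j * fls_const (L k c d) - fls_const (L k c d) * outer i j)) $$ m $$ m'
      = ?C (a - 1) $$ (- n) - ?C a $$ (- n + 1) + of_nat k * h * ?C a $$ (- n)"
    using outer_nth[of i j "a - 1"]
    by (simp add: of_nat u_minus_z_def m distrib_right left_diff_distrib fls_X_inv_times_conv_shift outer_nth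
        add.commute del: fls_mult_const_nth) (simp add: fls_X_inv_times_conv_shift outer_nth algebra_simps)
  also have "\<dots> = (\<Sum>r\<in>?W. sh k r n * comm_coeff i j c d (a - 1) r) - (\<Sum>r\<in>?W. sh k r n * comm_coeff i j c d a (r - 1))"
    unfolding L_comm shifted_sum by (simp add: algebra_simps)
  also have "\<dots> = (\<Sum>r\<in>?W. h * (sh k r n * exch_coeff i j c d a r))"
  proof -
    have "sh k r n * (h * z) = h * (sh k r n * z)" for r z by (metis sh_commute mult.assoc)
    then show ?thesis by (simp add: comm_coeff_step distrib_left sum.distrib)
  qed
  also have "\<dots> = h * (fls_const (l a c j) * L k i d - L k c j * fls_const (l a i d)) $$ (- n)"
    unfolding L_exch by (simp add: sum_distrib_left)
  also have "\<dots> = (h_series * (outer c j * fls_const (L k i d) - fls_const (L k c j) * outer i d)) $$ m $$ m'"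
    by (simp add: m h_series_def outer_nth)
  finally show "((u_minus_z + of_nat k * h_series) * (outer i j * fls_const (L k c d) - fls_const (L k c d) * outer i j)) $$ m $$ m'
    = (h_series * (outer c j * fls_const (L k i d) - fls_const (L k c j) * outer i d)) $$ m $$ m'" .
qed

lemma fls_const_central:
  assumes "\<And>y :: 'b::ring_1. c * y = y * c"
  shows "fls_const c * f = f * fls_const c"
  by (rule fls_eqI) (simp add: assms)

lemma half_fls:
  assumes "\<And>y :: 'b::ring_1. y + y = 0 \<Longrightarrow> y = 0" and "f + f = (0 :: 'b fls)"
  shows "f = 0"
proof (rule fls_eqI)
  fix n
  have "f $$ n + f $$ n = 0" using arg_cong[OF assms(2), of "\<lambda>g. g $$ n"] by simp
  from assms(1)[OF this] show "f $$ n = 0 $$ n" by simp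
qed

sublocale R_chain u_minus_z h_series
proof
  show "u_minus_z * y = y * u_minus_z" for y
    unfolding u_minus_z_def left_diff_distrib right_diff_distrib
    by (simp only: fls_X_inv_times_comm fls_const_central[of fls_X_inv, OF fls_X_inv_times_comm])
  show "h_series * y = y * h_series" for y
    unfolding h_series_def by (intro fls_const_central h_commute)
qed

sublocale RLL_product u_minus_z h_series outer "\<lambda>k i j. fls_const (L k i j)"
  by unfold_locales (unfold shift_def, rule RLL_series)

text \<open>
  The factor is monic of degree one in \<open>u\<close>, so it does not annihilate the leading coefficient of a
  series in \<open>u\<close>.
\<close>
lemma u_minus_z_cancel:
  assumes "(u_minus_z + of_int c * h_series) * y = 0"
  shows "y = 0"
proof (rule ccontr)
  assume "y \<noteq> 0"
  define d where "d = fls_subdegree y"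
  define e where "e = fls_X_inv - of_int c * fls_const h"
  have "u_minus_z + of_int c * h_series = fls_X_inv - fls_const e"
    by (simp add: u_minus_z_def h_series_def e_def fls_of_int fls_minus_const[symmetric])
  then have "((fls_X_inv - fls_const e) * y) $$ (d - 1) = 0" using assms by simp
  then have "y $$ d = 0"
    by (simp add: left_diff_distrib fls_X_inv_times_conv_shift d_def)
  then show False using \<open>y \<noteq> 0\<close> by (simp add: d_def)
qed

definition det_series :: "('n list \<Rightarrow> 'a) \<Rightarrow> 'n list \<Rightarrow> 'a fls" where
  "det_series \<epsilon> J = (\<Sum>I\<in>multi_indices CARD('n). fls_const (\<epsilon> I) * prod_list (map (\<lambda>k. L k (I ! k) (J ! k)) [0..<CARD('n)]))"

lemma det_series_commute:
  assumes alt: "alternating CARD('n) \<epsilon>" and \<epsilon>: "\<And>I y. \<epsilon> I * y = y * \<epsilon> I" and J: "length J = CARD('n)"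
  shows "l r i j * det_series \<epsilon> J $$ m = det_series \<epsilon> J $$ m * l r i j"
proof -
  define \<epsilon>' where "\<epsilon>' = (\<lambda>I. fls_const (fls_const (\<epsilon> I)))"
  have "alternating CARD('n) \<epsilon>'"
    using alt by (auto simp: alternating_def \<epsilon>'_def)
  moreover have "\<epsilon>' I * y = y * \<epsilon>' I" for I y
    unfolding \<epsilon>'_def by (intro fls_const_central \<epsilon>)
  ultimately have "outer i j * minor \<epsilon>' J = minor \<epsilon>' J * outer i j"
  proof (rule minor_commute[rotated -3])
    show "y = 0" if "y + y = 0" for y :: "'a fls fls"
      by (rule half_fls[OF half_fls[OF half] that])
    fix k i j c d
    have "fls_const (L k i j * L (Suc k) c d - L k c j * L (Suc k) i d)
       = fls_const (- (L k i d * L (Suc k) c j - L k c d * L (Suc k) i j))"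
      by (simp only: fused_antisymmetric[of k i j c d])
    then show "fls_const (L k i j) * fls_const (L (Suc k) c d) - fls_const (L k c j) * fls_const (L (Suc k) i d)
       = - (fls_const (L k i d) * fls_const (L (Suc k) c j) - fls_const (L k c d) * fls_const (L (Suc k) i j))"
      by (simp only: fls_const_mult_const fls_minus_const fls_const_uminus)
  qed (use u_minus_z_cancel J in auto)
  moreover have "minor \<epsilon>' J = fls_const (det_series \<epsilon> J)"
  proof -
    have "prod_list (map (\<lambda>k. fls_const (f k)) ks) = fls_const (prod_list (map f ks))" for f :: "nat \<Rightarrow> 'a fls" and ks
      by (induction ks) simp_all
    moreover have "(\<Sum>I\<in>S. fls_const (f I)) = fls_const (sum f S)" for f :: "'n list \<Rightarrow> 'a fls" and S
      by (induction S rule: infinite_finite_induct) (simp_all add: fls_plus_const)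
    ultimately show ?thesis
      by (simp add: minor_def det_series_def factors_def \<epsilon>'_def)
  qed
  ultimately have "(outer i j * fls_const (det_series \<epsilon> J)) $$ (- r) $$ m = (fls_const (det_series \<epsilon> J) * outer i j) $$ (- r) $$ m"
    by simp
  then show ?thesis by (simp add: outer_nth)
qed

end

section \<open>The quotients of the algebra by its filtration\<close>

lemma ring_ring_of_type_algebra: "ring (ring_of_type_algebra :: 'a::ring_1 ring)"
proof -
  have "\<exists>y. x + y = 0" for x :: 'a using add.right_inverse by blast
  then show ?thesis
    unfolding ring_of_type_algebra_def using add.right_inverse
    by unfold_locales (auto simp: algebra_simps Units_def)
qed

lemma ring_of_type_algebra_simps [simp]:
  "carrier ring_of_type_algebra = UNIV" "x \<otimes>\<^bsub>ring_of_type_algebra\<^esub> y = x * y" "\<one>\<^bsub>ring_of_type_algebra\<^esub> = 1"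
  "\<zero>\<^bsub>ring_of_type_algebra\<^esub> = 0" "x \<oplus>\<^bsub>ring_of_type_algebra\<^esub> y = x + y"
  by (simp_all add: ring_of_type_algebra_def)

lemma a_inv_ring_of_type_algebra [simp]: "\<ominus>\<^bsub>ring_of_type_algebra\<^esub> x = - (x :: 'a::ring_1)"
proof -
  interpret ring "ring_of_type_algebra :: 'a ring" by (rule ring_ring_of_type_algebra)
  show ?thesis by (rule minus_equality) auto
qed

lemma finsum_ring_of_type_algebra [simp]:
  "finsum (ring_of_type_algebra :: 'a::ring_1 ring) f S = sum f S"
proof -
  interpret ring "ring_of_type_algebra :: 'a ring" by (rule ring_ring_of_type_algebra)
  show ?thesis by (induction S rule: infinite_finite_induct) simp_all
qed

abbreviation Y_level :: "nat \<Rightarrow> 'n::finite free_alg set set ring" where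
  "Y_level p \<equiv> Y_alg Quot Y_filt p"

definition proj :: "nat \<Rightarrow> 'n::finite free_alg \<Rightarrow> 'n free_alg set set" where
  "proj p x = to_Y_compl x p"

lemma ideal_RLL: "ideal (RLL_ideal :: 'n::finite free_alg set) free_alg_ring"
  unfolding RLL_ideal_def by (rule ring.genideal_ideal[OF ring_ring_of_type_algebra]) simp

lemma ring_Y_alg: "ring (Y_alg :: 'n::finite free_alg set ring)"
  unfolding Y_alg_def by (rule ideal.quotient_is_ring[OF ideal_RLL])

lemma Y_class_hom: "Y_class \<in> ring_hom free_alg_ring (Y_alg :: 'n::finite free_alg set ring)"
  using ideal.rcos_ring_hom[OF ideal_RLL] unfolding Y_alg_def Y_class_def[abs_def] .

lemma carrier_Y_alg: "carrier (Y_alg :: 'n::finite free_alg set ring) = range Y_class"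
  unfolding Y_alg_def FactRing_def A_RCOSETS_def' Y_class_def by auto

lemma Y_class_carrier: "Y_class x \<in> carrier Y_alg"
  by (simp add: carrier_Y_alg)

lemma ideal_Y_filt: "ideal (Y_filt p) (Y_alg :: 'n::finite free_alg set ring)"
  unfolding Y_filt_def by (rule ring.genideal_ideal[OF ring_Y_alg]) (auto simp: Y_class_carrier)

lemma ring_Y_level: "ring (Y_level p :: 'n::finite free_alg set set ring)"
  by (rule ideal.quotient_is_ring[OF ideal_Y_filt])

lemma proj_eq: "proj p x = Y_filt p +>\<^bsub>Y_alg\<^esub> Y_class x"
  by (simp add: proj_def to_Y_compl_def inv_lim_map_def)

lemma proj_hom: "proj p \<in> ring_hom free_alg_ring (Y_level p :: 'n::finite free_alg set set ring)"
proof -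
  have "proj p = (+>\<^bsub>Y_alg\<^esub>) (Y_filt p) \<circ> (Y_class :: 'n free_alg \<Rightarrow> _)"
    by (simp add: fun_eq_iff proj_eq)
  then show ?thesis
    using ring_hom_trans[OF Y_class_hom ideal.rcos_ring_hom[OF ideal_Y_filt]] by metis
qed

lemma carrier_Y_level: "carrier (Y_level p :: 'n::finite free_alg set set ring) = range (proj p)"
  by (auto simp: FactRing_def A_RCOSETS_def' carrier_Y_alg proj_eq)

lemma proj_simps:
  "proj p (x + y) = proj p x \<oplus>\<^bsub>Y_level p\<^esub> proj p y"
  "proj p (x * y) = proj p x \<otimes>\<^bsub>Y_level p\<^esub> proj p y"
  "proj p 1 = \<one>\<^bsub>Y_level p\<^esub>"
  "proj p 0 = \<zero>\<^bsub>Y_level p\<^esub>"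
  using ring_hom_add[OF proj_hom] ring_hom_mult[OF proj_hom] ring_hom_one[OF proj_hom]
    ring_hom_zero[OF proj_hom ring_ring_of_type_algebra ring_Y_level] by simp_all

lemma proj_ring_hom_ring: "ring_hom_ring free_alg_ring (Y_level p :: 'n::finite free_alg set set ring) (proj p)"
  by (intro ring_hom_ringI2 ring_ring_of_type_algebra ring_Y_level proj_hom)

lemma proj_uminus: "proj p (- x) = \<ominus>\<^bsub>Y_level p\<^esub> proj p x"
proof -
  interpret ring_hom_ring free_alg_ring "Y_level p" "proj p" by (rule proj_ring_hom_ring)
  show ?thesis using hom_a_inv[of x] by simp
qed

lemma proj_sum: "proj p (sum f S) = (\<Oplus>\<^bsub>Y_level p\<^esub> i \<in> S. proj p (f i))"
proof -
  interpret ring_hom_ring free_alg_ring "Y_level p" "proj p" by (rule proj_ring_hom_ring)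
  show ?thesis using hom_finsum[of f S] by (simp add: comp_def)
qed

lemma proj_eq_iff: "proj p x = proj p y \<longleftrightarrow> Y_class (x - y) \<in> Y_filt p"
proof -
  have "Y_class x \<ominus>\<^bsub>Y_alg\<^esub> Y_class y = Y_class (x - y)"
  proof -
    interpret ring_hom_ring free_alg_ring Y_alg Y_class
      by (intro ring_hom_ringI2 ring_ring_of_type_algebra ring_Y_alg Y_class_hom)
    show ?thesis using hom_add[of x "- y"] hom_a_inv[of y] by (simp add: a_minus_def)
  qed
  then show ?thesis
    unfolding proj_eq
    using ring.quotient_eq_iff_same_a_r_cos[OF ring_Y_alg ideal_Y_filt Y_class_carrier[of x] Y_class_carrier[of y], of p] by simp
qed

lemma proj_eq_0_iff: "proj p x = proj p 0 \<longleftrightarrow> Y_class x \<in> Y_filt p"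
  using proj_eq_iff[of p x 0] by simp

lemma proj_h_power: "proj p (scalar (fps_X ^ (p + 1))) = proj p 0"
  unfolding proj_eq_0_iff Y_filt_def
  by (rule subsetD[OF ring.genideal_self[OF ring_Y_alg]]) (auto simp: Y_class_carrier)

lemma proj_lam: "r > int p \<Longrightarrow> proj p (lam i j (- r)) = proj p 0"
  unfolding proj_eq_0_iff Y_filt_def
  by (rule subsetD[OF ring.genideal_self[OF ring_Y_alg]]) (auto simp: Y_class_carrier)

lemma Y_class_RLL:
  assumes "length I = 2" "length J = 2"
  shows "Y_class (RLL_lhs a b I J) = Y_class (RLL_rhs a b I J)"
proof -
  have "RLL_lhs a b I J - RLL_rhs a b I J \<in> RLL_ideal"
    unfolding RLL_ideal_def
    by (rule subsetD[OF ring.genideal_self[OF ring_ring_of_type_algebra]]) (use assms in \<open>auto simp: multi_indices_def\<close>)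
  then show ?thesis
    unfolding Y_class_def
    using ring.quotient_eq_iff_same_a_r_cos[OF ring_ring_of_type_algebra ideal_RLL, of "RLL_lhs a b I J" "RLL_rhs a b I J"]
    by (simp add: a_minus_def)
qed

lemma proj_RLL:
  assumes "length I = 2" "length J = 2"
  shows "proj p (RLL_lhs a b I J) = proj p (RLL_rhs a b I J)"
  unfolding proj_eq Y_class_RLL[OF assms] ..

lemma scalar_simps:
  "scalar (a + b) = scalar a + scalar b" "scalar (a * b) = scalar a * scalar b"
  "scalar 1 = 1" "scalar 0 = 0" "scalar (- a) = - scalar a" "scalar (a - b) = scalar a - scalar b"
  by (simp_all add: scalar_def single_add mult_single single_uminus single_diff)

lemma Y_filt_antimono: "p \<le> q \<Longrightarrow> Y_filt q \<subseteq> (Y_filt p :: 'n::finite free_alg set set)"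
proof -
  assume pq: "p \<le> q"
  have "fps_X ^ (q + 1) = (fps_X ^ (q - p) * fps_X ^ (p + 1) :: complex fps)"
    using pq by (simp add: power_add[symmetric])
  then have "proj p (scalar (fps_X ^ (q + 1))) = (proj p (scalar (fps_X ^ (q - p)) * 0) :: 'n free_alg set set)"
    by (simp only: scalar_simps proj_simps proj_h_power)
  then have 1: "Y_class (scalar (fps_X ^ (q + 1))) \<in> (Y_filt p :: 'n free_alg set set)"
    using proj_eq_0_iff by (metis mult_zero_right)
  have 2: "Y_class (lam i j (- r)) \<in> Y_filt p" if "r > int q" for i j :: 'n and r
    unfolding proj_eq_0_iff[symmetric] by (rule proj_lam) (use that pq in auto)
  show ?thesis
    unfolding Y_filt_def[of q] by (rule ring.genideal_minimal[OF ring_Y_alg ideal_Y_filt]) (use 1 2 in auto)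
qed

lemma proj_mono: "p \<le> q \<Longrightarrow> proj q x = proj q y \<Longrightarrow> proj p x = proj p y"
  using Y_filt_antimono by (auto simp: proj_eq_iff)

text \<open>
  The constant term at \<open>h = 0\<close>, the homomorphism to \<open>\<complex>\<close> that kills \<open>h\<close> and all generators.  It
  factors through every quotient, so that no quotient is the zero ring.
\<close>
definition augmentation :: "'n free_alg \<Rightarrow> complex" where
  "augmentation x = fps_nth (Poly_Mapping.lookup x 0) 0"

lemma free_mon_add_eq_0_iff: "(0 :: 'g free_mon) = a + b \<longleftrightarrow> a = 0 \<and> b = 0"
  by (cases a; cases b) (auto simp: zero_free_mon_def)

lemma augmentation_simps [simp]:
  "augmentation (x + y) = augmentation x + augmentation y"
  "augmentation (- x) = - augmentation x"
  "augmentation (x - y) = augmentation x - augmentation y"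
  "augmentation (x * y) = augmentation x * augmentation y"
  "augmentation 0 = 0" "augmentation 1 = 1" "augmentation (lam i j r) = 0"
  "augmentation (scalar c) = fps_nth c 0"
proof -
  have "(Poly_Mapping.lookup y q when 0 = l + q) = ((Poly_Mapping.lookup y q when q = 0) when l = 0)" for l q
    by (simp add: free_mon_add_eq_0_iff when_def)
  then have "Poly_Mapping.lookup (x * y) 0 = (\<Sum>l. Poly_Mapping.lookup x l * (\<Sum>q. (Poly_Mapping.lookup y q when q = 0) when l = 0))"
    by (simp only: lookup_mult)
  also have "\<dots> = (\<Sum>l. Poly_Mapping.lookup x l * Poly_Mapping.lookup y 0 when l = 0)"
    by (intro Sum_any.cong) (simp add: when_def)
  also have "\<dots> = Poly_Mapping.lookup x 0 * Poly_Mapping.lookup y 0" by simp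
  finally show "augmentation (x * y) = augmentation x * augmentation y"
    by (simp add: augmentation_def fps_mult_nth_0)
qed (simp_all add: augmentation_def lookup_add lookup_minus lookup_one lam_def scalar_def lookup_single zero_free_mon_def)

lemma augmentation_sum [simp]: "augmentation (sum f S) = (\<Sum>i\<in>S. augmentation (f i))"
  by (induction S rule: infinite_finite_induct) simp_all

definition augmentation_ideal :: "'n free_alg set" where
  "augmentation_ideal = {x. augmentation x = 0}"

lemma ideal_augmentation: "ideal augmentation_ideal (free_alg_ring :: 'n free_alg ring)"
proof (rule idealI[OF ring_ring_of_type_algebra])
  show "subgroup augmentation_ideal (add_monoid (free_alg_ring :: 'n free_alg ring))"
  proof
    show "inv\<^bsub>add_monoid free_alg_ring\<^esub> x \<in> augmentation_ideal" if "x \<in> augmentation_ideal" for x :: "'n free_alg"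
      using that a_inv_ring_of_type_algebra[of x] by (simp add: a_inv_def augmentation_ideal_def)
  qed (auto simp: augmentation_ideal_def)
qed (auto simp: augmentation_ideal_def)

lemma RLL_ideal_le_augmentation: "RLL_ideal \<subseteq> (augmentation_ideal :: 'n::finite free_alg set)"
  unfolding RLL_ideal_def
  by (rule ring.genideal_minimal[OF ring_ring_of_type_algebra ideal_augmentation])
     (auto simp: augmentation_ideal_def RLL_lhs_def RLL_rhs_def tensor_mult_def tensor_leg_def L_coeff_def
        if_distrib[of augmentation] cong: if_cong intro!: sum.neutral)

lemma Y_filt_proper: "proj p 1 \<noteq> (proj p 0 :: 'n::finite free_alg set set)"
proof
  let ?A = "Y_class ` (augmentation_ideal :: 'n free_alg set)"
  assume "proj p 1 = (proj p 0 :: 'n::finite free_alg set set)"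
  then have "Y_class 1 \<in> (Y_filt p :: 'n free_alg set set)" by (simp add: proj_eq_0_iff)
  moreover have "ideal ?A Y_alg"
    using ring.ring_ideal_imp_quot_ideal[OF ring_ring_of_type_algebra ideal_RLL ideal_augmentation]
    unfolding Y_alg_def Y_class_def[abs_def] .
  then have "Y_filt p \<subseteq> ?A"
    unfolding Y_filt_def
    by (rule ring.genideal_minimal[OF ring_Y_alg])
       (auto simp: augmentation_ideal_def intro!: imageI)
  ultimately obtain x :: "'n free_alg" where x: "augmentation x = 0" "Y_class 1 = Y_class x"
    by (auto simp: augmentation_ideal_def)
  have "1 - x \<in> RLL_ideal"
    using x(2) ring.quotient_eq_iff_same_a_r_cos[OF ring_ring_of_type_algebra ideal_RLL, of 1 x]
    by (simp add: a_minus_def Y_class_def)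
  then have "augmentation (1 - x) = 0" using RLL_ideal_le_augmentation augmentation_ideal_def by blast
  with x(1) show False by simp
qed

lemma scalar_central: "scalar c * x = x * scalar c"
proof (induction x rule: update_induct)
  case (update f a b)
  have "Poly_Mapping.update a b f = f + Poly_Mapping.single a b"
    using update(1) by (intro poly_mapping_eqI) (auto simp: lookup_update lookup_add lookup_single in_keys_iff when_def)
  then show ?case
    using update.IH by (simp add: distrib_left distrib_right scalar_def mult_single mult.commute)
qed simp

section \<open>The completed algebra\<close>

text \<open>
  Up to any given level, a compatible family is the image of a single element of the free algebra.
  This reduces computations in the inverse limit to the free algebra.
\<close>
lemma Y_compl_carrier_iff:
  "x \<in> carrier (Y_compl :: 'n::finite Y_compl_elem ring) \<longleftrightarrow> (\<forall>q. \<exists>y. \<forall>p\<le>q. x p = proj p y)"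
proof
  assume x: "x \<in> carrier (Y_compl :: 'n Y_compl_elem ring)"
  show "\<forall>q. \<exists>y. \<forall>p\<le>q. x p = proj p y"
  proof
    fix q
    have "x q \<in> carrier (Y_level q)" using x by (simp add: Y_compl_def inv_lim_def)
    then obtain y where y: "x q = proj q y" by (auto simp: carrier_Y_level)
    have "x p = proj p y" if "p \<le> q" for p
      using x that y Y_class_carrier[of y] by (auto simp: Y_compl_def inv_lim_def proj_eq)
    then show "\<exists>y. \<forall>p\<le>q. x p = proj p y" by blast
  qed
next
  assume *: "\<forall>q. \<exists>y. \<forall>p\<le>q. x p = proj p y"
  have "x p \<in> carrier (Y_level p)" for p using *[rule_format, of p] by (auto simp: carrier_Y_level)
  moreover have "x p = Y_filt p +>\<^bsub>Y_alg\<^esub> z"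
    if "p \<le> q" "z \<in> carrier Y_alg" "x q = Y_filt q +>\<^bsub>Y_alg\<^esub> z" for p q z
  proof -
    from that(2) obtain z' where z: "z = Y_class z'" by (auto simp: carrier_Y_alg)
    from * obtain y where "\<forall>p\<le>q. x p = proj p y" by blast
    then show ?thesis using that z proj_mono[of p q y z'] by (simp add: proj_eq)
  qed
  ultimately show "x \<in> carrier Y_compl" by (auto simp: Y_compl_def inv_lim_def)
qed

lemma Y_compl_carrierI:
  assumes "\<And>q. \<exists>y. \<forall>p\<le>q. x p = proj p y"
  shows "x \<in> carrier Y_compl"
  using assms by (simp add: Y_compl_carrier_iff)

lemma Y_compl_component: "x \<in> carrier Y_compl \<Longrightarrow> x p \<in> carrier (Y_level p)"
  by (simp add: Y_compl_def inv_lim_def)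

lemma Y_compl_simps:
  "(x \<otimes>\<^bsub>Y_compl\<^esub> y) p = x p \<otimes>\<^bsub>Y_level p\<^esub> y p"
  "(x \<oplus>\<^bsub>Y_compl\<^esub> y) p = x p \<oplus>\<^bsub>Y_level p\<^esub> y p"
  "\<one>\<^bsub>Y_compl\<^esub> p = \<one>\<^bsub>Y_level p\<^esub>" "\<zero>\<^bsub>Y_compl\<^esub> p = \<zero>\<^bsub>Y_level p\<^esub>"
  by (simp_all add: Y_compl_def inv_lim_def)

lemma to_Y_compl_carrier: "to_Y_compl x \<in> carrier Y_compl"
  by (rule Y_compl_carrierI) (auto simp: proj_def)

lemma ring_Y_compl: "ring (Y_compl :: 'n::finite Y_compl_elem ring)"
proof -
  let ?R = "Y_compl :: 'n Y_compl_elem ring"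
  have add: "x \<oplus>\<^bsub>?R\<^esub> y \<in> carrier ?R" if "x \<in> carrier ?R" "y \<in> carrier ?R" for x y
  proof (rule Y_compl_carrierI)
    fix q
    obtain a b where "\<forall>p\<le>q. x p = proj p a" "\<forall>p\<le>q. y p = proj p b"
      using \<open>x \<in> _\<close> \<open>y \<in> _\<close> unfolding Y_compl_carrier_iff by meson
    then show "\<exists>c. \<forall>p\<le>q. (x \<oplus>\<^bsub>?R\<^esub> y) p = proj p c"
      by (intro exI[of _ "a + b"]) (simp add: Y_compl_simps proj_simps)
  qed
  have mult: "x \<otimes>\<^bsub>?R\<^esub> y \<in> carrier ?R" if "x \<in> carrier ?R" "y \<in> carrier ?R" for x y
  proof (rule Y_compl_carrierI)
    fix q
    obtain a b where "\<forall>p\<le>q. x p = proj p a" "\<forall>p\<le>q. y p = proj p b"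
      using \<open>x \<in> _\<close> \<open>y \<in> _\<close> unfolding Y_compl_carrier_iff by meson
    then show "\<exists>c. \<forall>p\<le>q. (x \<otimes>\<^bsub>?R\<^esub> y) p = proj p c"
      by (intro exI[of _ "a * b"]) (simp add: Y_compl_simps proj_simps)
  qed
  have zero: "\<zero>\<^bsub>?R\<^esub> \<in> carrier ?R"
    by (rule Y_compl_carrierI, rule exI[of _ 0]) (simp add: Y_compl_simps proj_simps)
  have one: "\<one>\<^bsub>?R\<^esub> \<in> carrier ?R"
    by (rule Y_compl_carrierI, rule exI[of _ 1]) (simp add: Y_compl_simps proj_simps)
  have neg: "\<exists>y\<in>carrier ?R. y \<oplus>\<^bsub>?R\<^esub> x = \<zero>\<^bsub>?R\<^esub>" if "x \<in> carrier ?R" for x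
  proof
    show "(\<lambda>p. \<ominus>\<^bsub>Y_level p\<^esub> x p) \<in> carrier ?R"
    proof (rule Y_compl_carrierI)
      fix q
      obtain a where "\<forall>p\<le>q. x p = proj p a" using \<open>x \<in> _\<close> unfolding Y_compl_carrier_iff by meson
      then show "\<exists>c. \<forall>p\<le>q. \<ominus>\<^bsub>Y_level p\<^esub> x p = proj p c"
        by (intro exI[of _ "- a"]) (simp add: proj_uminus)
    qed
    show "(\<lambda>p. \<ominus>\<^bsub>Y_level p\<^esub> x p) \<oplus>\<^bsub>?R\<^esub> x = \<zero>\<^bsub>?R\<^esub>"
    proof
      fix p
      interpret ring "Y_level p :: 'n free_alg set set ring" by (rule ring_Y_level)
      show "((\<lambda>p. \<ominus>\<^bsub>Y_level p\<^esub> x p) \<oplus>\<^bsub>?R\<^esub> x) p = \<zero>\<^bsub>?R\<^esub> p"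
        using Y_compl_component[OF that, of p] by (simp add: Y_compl_simps l_neg)
    qed
  qed
  note comp = Y_compl_component
  have lev: "ring (Y_level p :: 'n free_alg set set ring)" for p by (rule ring_Y_level)
  note lev_rules = ring.ring_simprules[OF lev] monoid.r_one[OF ring.is_monoid[OF lev]]
  show ?thesis
  proof (rule ringI)
    show "abelian_group ?R"
      by (rule abelian_groupI) (use add zero neg in \<open>auto simp: fun_eq_iff Y_compl_simps lev_rules comp\<close>)
    show "monoid ?R"
      by (rule monoidI) (use mult one in \<open>auto simp: fun_eq_iff Y_compl_simps lev_rules comp\<close>)
  qed (auto simp: fun_eq_iff Y_compl_simps lev_rules comp)
qed

lemma finsum_Y_compl_component:
  assumes "\<And>i. i \<in> S \<Longrightarrow> f i \<in> carrier (Y_compl :: 'n::finite Y_compl_elem ring)"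
  shows "(\<Oplus>\<^bsub>Y_compl\<^esub> i \<in> S. f i) p = (\<Oplus>\<^bsub>Y_level p\<^esub> i \<in> S. f i p)"
proof -
  have "(\<lambda>x. x p) \<in> ring_hom (Y_compl :: 'n Y_compl_elem ring) (Y_level p)"
    by (rule ring_hom_memI) (auto simp: Y_compl_simps Y_compl_component)
  then interpret ring_hom_ring Y_compl "Y_level p :: 'n free_alg set set ring" "\<lambda>x. x p"
    by (intro ring_hom_ringI2 ring_Y_compl ring_Y_level)
  show ?thesis using hom_finsum[of f S] assms by (simp add: comp_def Pi_iff)
qed

text \<open>
  An infinite sum is formed componentwise.  The sums of the components are compatible since the support
  of the family can only shrink when the level decreases.
\<close>
lemma Y_compl_sum_component:
  assumes f: "\<And>i. f i \<in> carrier (Y_compl :: 'n::finite Y_compl_elem ring)"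
    and fin: "\<And>p. finite {i. f i p \<noteq> \<zero>\<^bsub>Y_level p\<^esub>}"
  shows "Y_compl_sum f UNIV \<in> carrier Y_compl"
    and "Y_compl_sum f UNIV p = (\<Oplus>\<^bsub>Y_level p\<^esub> i \<in> {i. f i p \<noteq> \<zero>\<^bsub>Y_level p\<^esub>}. f i p)"
proof -
  define x where "x p = (\<Oplus>\<^bsub>Y_level p\<^esub> i \<in> {i. f i p \<noteq> \<zero>\<^bsub>Y_level p\<^esub>}. f i p)" for p
  have "x \<in> carrier Y_compl"
  proof (rule Y_compl_carrierI)
    fix q
    define S where "S = {i. f i q \<noteq> \<zero>\<^bsub>Y_level q\<^esub>}"
    have "\<forall>i. \<exists>y. \<forall>p\<le>q. f i p = proj p y" using f unfolding Y_compl_carrier_iff by blast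
    then obtain y where y: "\<And>i p. p \<le> q \<Longrightarrow> f i p = proj p (y i)" by metis
    have "x p = proj p (sum y S)" if p: "p \<le> q" for p
    proof -
      interpret ring "Y_level p :: 'n free_alg set set ring" by (rule ring_Y_level)
      have "f i p = \<zero>\<^bsub>Y_level p\<^esub>" if "i \<notin> S" for i
      proof -
        have "proj q (y i) = proj q 0" using that y[of q i] by (simp add: S_def proj_simps)
        then show ?thesis using proj_mono[OF p] y[OF p] by (metis proj_simps(4))
      qed
      then have sub: "{i. f i p \<noteq> \<zero>\<^bsub>Y_level p\<^esub>} \<subseteq> S" by blast
      have "x p = (\<Oplus>\<^bsub>Y_level p\<^esub> i \<in> S. f i p)"
        unfolding x_def
        by (rule add.finprod_mono_neutral_cong_left)
           (use sub fin[of q] Y_compl_component[OF f] in \<open>auto simp: S_def\<close>)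
      also have "\<dots> = proj p (sum y S)"
        unfolding proj_sum y[OF p] ..
      finally show ?thesis .
    qed
    then show "\<exists>c. \<forall>p\<le>q. x p = proj p c" by blast
  qed
  then have has: "inv_lim_has_sum Y_alg Y_filt f UNIV x"
    using f fin unfolding inv_lim_has_sum_def by (simp add: x_def Y_compl_def)
  have "Y_compl_sum f UNIV = x"
    unfolding inv_lim_sum_def
  proof (rule the_equality)
    show "inv_lim_has_sum Y_alg Y_filt f UNIV x" by (rule has)
    fix x' assume "inv_lim_has_sum Y_alg Y_filt f UNIV x'"
    then show "x' = x" by (auto simp: inv_lim_has_sum_def x_def fun_eq_iff)
  qed
  then show "Y_compl_sum f UNIV \<in> carrier Y_compl"
    "Y_compl_sum f UNIV p = (\<Oplus>\<^bsub>Y_level p\<^esub> i \<in> {i. f i p \<noteq> \<zero>\<^bsub>Y_level p\<^esub>}. f i p)"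
    using \<open>x \<in> carrier Y_compl\<close> x_def by simp_all
qed

section \<open>The critical level\<close>

text \<open>
  A level at which some coefficient of the series does not commute with some element, if there is any such
  level.
\<close>
definition critical_level :: "'n::finite itself \<Rightarrow> nat" where
  "critical_level (T :: 'n itself) = (SOME p. \<exists>n y.
     (LL_coeff n :: 'n Y_compl_elem) p \<otimes>\<^bsub>Y_level p\<^esub> proj p y \<noteq> proj p y \<otimes>\<^bsub>Y_level p\<^esub> LL_coeff n p)"

abbreviation crit_proj :: "'n::finite free_alg \<Rightarrow> 'n free_alg set set" where
  "crit_proj \<equiv> proj (critical_level TYPE('n))"

text \<open>The algebra \<open>Y / I\<^sub>p\<close> at the critical level \<open>p\<close>, as a quotient of the free algebra.\<close>
quotient_type (overloaded) 'n crit = "'n::finite free_alg" / "\<lambda>x y. crit_proj x = crit_proj y"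
  morphisms rep_crit crit
  by (rule equivpI) (auto simp: reflp_def symp_def transp_def)

instantiation crit :: (finite) ring_1
begin

lift_definition zero_crit :: "'a crit" is 0 .
lift_definition one_crit :: "'a crit" is 1 .
lift_definition plus_crit :: "'a crit \<Rightarrow> 'a crit \<Rightarrow> 'a crit" is "(+)" by (simp add: proj_simps)
lift_definition minus_crit :: "'a crit \<Rightarrow> 'a crit \<Rightarrow> 'a crit" is "(-)"
  by (simp only: diff_conv_add_uminus proj_simps proj_uminus)
lift_definition uminus_crit :: "'a crit \<Rightarrow> 'a crit" is uminus by (simp add: proj_uminus)
lift_definition times_crit :: "'a crit \<Rightarrow> 'a crit \<Rightarrow> 'a crit" is "(*)" by (simp add: proj_simps)

instance
  by standard (transfer; simp add: algebra_simps Y_filt_proper Y_filt_proper[symmetric])+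

end

lemma crit_simps:
  "crit (x + y) = crit x + crit y" "crit (x * y) = crit x * crit y" "crit (x - y) = crit x - crit y"
  "crit (- x) = - crit x" "crit 0 = 0" "crit 1 = 1"
  by (rule plus_crit.abs_eq[symmetric] times_crit.abs_eq[symmetric] minus_crit.abs_eq[symmetric]
      uminus_crit.abs_eq[symmetric] zero_crit.abs_eq[symmetric] one_crit.abs_eq[symmetric])+

lemma crit_eq_iff: "crit x = crit y \<longleftrightarrow> crit_proj x = crit_proj y"
  by (rule crit.abs_eq_iff)

lemma crit_surj: "\<exists>x. y = crit x"
  by (rule exI[of _ "rep_crit y"]) (simp only: Quotient3_abs_rep[OF Quotient3_crit])

lemma crit_sum: "crit (sum f S) = (\<Sum>i\<in>S. crit (f i))"
  by (induction S rule: infinite_finite_induct) (simp_all add: crit_simps)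

text \<open>The component of an element of the completed algebra at the critical level.\<close>
definition crit_val :: "'n::finite Y_compl_elem \<Rightarrow> 'n crit" where
  "crit_val x = crit (SOME y. crit_proj y = x (critical_level TYPE('n)))"

lemma crit_val_eq: "x (critical_level TYPE('n)) = crit_proj y \<Longrightarrow> crit_val x = crit (y :: 'n::finite free_alg)"
  unfolding crit_val_def crit_eq_iff by (rule someI2[of _ y]) auto

lemma carrier_crit_proj:
  assumes "x \<in> carrier (Y_compl :: 'n::finite Y_compl_elem ring)"
  obtains y where "x (critical_level TYPE('n)) = crit_proj y"
  using Y_compl_component[OF assms] by (auto simp: carrier_Y_level)

lemma crit_val_to_Y_compl [simp]: "crit_val (to_Y_compl x) = crit x"
  by (rule crit_val_eq) (simp add: proj_def)

lemma crit_val_zero [simp]: "crit_val \<zero>\<^bsub>Y_compl\<^esub> = 0"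
  using crit_val_eq[of "\<zero>\<^bsub>Y_compl\<^esub>" 0] by (simp add: Y_compl_simps proj_simps crit_simps)

lemma crit_val_one [simp]: "crit_val \<one>\<^bsub>Y_compl\<^esub> = 1"
  using crit_val_eq[of "\<one>\<^bsub>Y_compl\<^esub>" 1] by (simp add: Y_compl_simps proj_simps crit_simps)

lemma crit_val_mult [simp]:
  assumes x: "x \<in> carrier Y_compl" and y: "y \<in> carrier Y_compl"
  shows "crit_val (x \<otimes>\<^bsub>Y_compl\<^esub> y) = crit_val x * crit_val y"
proof -
  obtain a b where "x (critical_level TYPE('a)) = crit_proj a" "y (critical_level TYPE('a)) = crit_proj b"
    using x y by (metis carrier_crit_proj)
  then show ?thesis
    using crit_val_eq[of x a] crit_val_eq[of y b] crit_val_eq[of "x \<otimes>\<^bsub>Y_compl\<^esub> y" "a * b"]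
    by (simp add: Y_compl_simps proj_simps crit_simps)
qed

lemma crit_val_eq_0_iff:
  assumes "x \<in> carrier (Y_compl :: 'n::finite Y_compl_elem ring)"
  shows "crit_val x = 0 \<longleftrightarrow> x (critical_level TYPE('n)) = \<zero>\<^bsub>Y_level (critical_level TYPE('n))\<^esub>"
proof -
  obtain a where a: "x (critical_level TYPE('n)) = crit_proj a" using assms by (rule carrier_crit_proj)
  show ?thesis
    using crit_val_eq[of x a] crit_eq_iff[of a 0] a by (simp add: crit_simps proj_simps)
qed

lemma crit_val_finsum:
  assumes "\<And>i. i \<in> S \<Longrightarrow> f i \<in> carrier (Y_compl :: 'n::finite Y_compl_elem ring)"
    and "x (critical_level TYPE('n)) = (\<Oplus>\<^bsub>Y_level (critical_level TYPE('n))\<^esub> i \<in> S. f i (critical_level TYPE('n)))"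
  shows "crit_val x = (\<Sum>i\<in>S. crit_val (f i))"
proof -
  have "\<forall>i\<in>S. \<exists>y. f i (critical_level TYPE('n)) = crit_proj y"
    using assms(1) carrier_crit_proj by metis
  then obtain y where y: "\<And>i. i \<in> S \<Longrightarrow> f i (critical_level TYPE('n)) = crit_proj (y i)" by metis
  interpret ring "Y_level (critical_level TYPE('n)) :: 'n free_alg set set ring" by (rule ring_Y_level)
  have "x (critical_level TYPE('n)) = crit_proj (sum y S)"
    unfolding assms(2) proj_sum by (rule add.finprod_cong') (use y in \<open>auto simp: carrier_Y_level\<close>)
  then have "crit_val x = crit (sum y S)" by (rule crit_val_eq)
  also have "\<dots> = (\<Sum>i\<in>S. crit_val (f i))"
    unfolding crit_sum by (intro sum.cong refl) (metis y crit_val_eq)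
  finally show ?thesis .
qed

lemma crit_val_sum:
  assumes "\<And>i. i \<in> S \<Longrightarrow> f i \<in> carrier (Y_compl :: 'n::finite Y_compl_elem ring)"
  shows "crit_val (\<Oplus>\<^bsub>Y_compl\<^esub> i \<in> S. f i) = (\<Sum>i\<in>S. crit_val (f i))"
  by (rule crit_val_finsum) (use assms finsum_Y_compl_component[of S f] in auto)

lemma crit_val_Y_compl_sum:
  assumes f: "\<And>i. f i \<in> carrier (Y_compl :: 'n::finite Y_compl_elem ring)"
    and fin: "\<And>p. finite {i. f i p \<noteq> \<zero>\<^bsub>Y_level p\<^esub>}"
    and W: "finite W" "\<And>i. i \<notin> W \<Longrightarrow> crit_val (f i) = 0"
  shows "crit_val (Y_compl_sum f UNIV) = (\<Sum>i\<in>W. crit_val (f i))"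
proof -
  let ?p = "critical_level TYPE('n)"
  have "crit_val (Y_compl_sum f UNIV) = (\<Sum>i\<in>{i. f i ?p \<noteq> \<zero>\<^bsub>Y_level ?p\<^esub>}. crit_val (f i))"
    by (rule crit_val_finsum) (use f Y_compl_sum_component(2)[OF f fin] in auto)
  also have "\<dots> = (\<Sum>i\<in>W. crit_val (f i))"
    using W crit_val_eq_0_iff[OF f] by (intro sum.mono_neutral_left) auto
  finally show ?thesis .
qed

text \<open>The scalars and the \<open>\<lambda>\<^sub>i\<^sub>j\<^sup>(\<^sup>r\<^sup>)\<close> generate the free algebra as a ring.\<close>
lemma crit_induct [case_names scalar lam add mult]:
  assumes scalar: "\<And>c. P (crit (scalar c))" and lam: "\<And>i j r. P (crit (lam i j r))"
    and add: "\<And>x y. P x \<Longrightarrow> P y \<Longrightarrow> P (x + y)" and mult: "\<And>x y. P x \<Longrightarrow> P y \<Longrightarrow> P (x * y)"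
  shows "P (x :: 'n::finite crit)"
proof -
  have mon: "P (crit (Poly_Mapping.single (Free_Mon w) 1))" for w
  proof (induction w)
    case Nil
    then show ?case using scalar[of 1] by (simp add: scalar_def zero_free_mon_def)
  next
    case (Cons g w)
    obtain i j r where g: "g = (i, j, r)" by (cases g)
    have "Poly_Mapping.single (Free_Mon (g # w)) (1 :: complex fps) = lam i j r * Poly_Mapping.single (Free_Mon w) 1"
      by (simp add: lam_def mult_single g)
    then show ?case using mult[OF lam Cons.IH] by (simp add: crit_simps)
  qed
  have "P (crit y)" for y
  proof (induction y rule: update_induct)
    case const
    show ?case using scalar[of 0] by (simp add: scalar_def)
  next
    case (update f a b)
    obtain w where a: "a = Free_Mon w" by (cases a)
    have "Poly_Mapping.update a b f = scalar b * Poly_Mapping.single (Free_Mon w) 1 + f"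
      using update(1) unfolding scalar_def mult_single
      by (intro poly_mapping_eqI) (auto simp: lookup_update lookup_add lookup_single in_keys_iff when_def a)
    then show ?case using add[OF mult[OF scalar mon] update.IH] by (simp add: crit_simps)
  qed
  then show ?thesis using crit_surj by metis
qed

section \<open>The defining relations at the critical level\<close>

lemma sum_multi_indices_2:
  "(\<Sum>K\<in>multi_indices 2. F K) = (\<Sum>p\<in>UNIV. \<Sum>q\<in>UNIV. F [p, q :: 'n::finite])"
proof -
  have "(\<Sum>K\<in>multi_indices 2. F K) = (\<Sum>(p, q)\<in>UNIV \<times> UNIV. F [p, q])"
    by (rule sum.reindex_bij_witness[where i = "\<lambda>(p, q). [p, q]" and j = "\<lambda>K. (K ! 0, K ! 1)"])
       (auto simp: multi_indices_def length_Suc_conv numeral_2_eq_2)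
  then show ?thesis by (simp add: sum.cartesian_product)
qed

lemma all_less_2: "(\<forall>k<2. P k) \<longleftrightarrow> P 0 \<and> P (1::nat)"
  by (auto simp: numeral_2_eq_2 less_Suc_eq)

lemma tensor_leg_2:
  "tensor_leg free_alg_ring 2 0 x [i, k] [j, l] = (if l = k then x i j else 0)"
  "tensor_leg free_alg_ring 2 1 x [i, k] [j, l] = (if j = i then x k l else 0)"
  by (auto simp: tensor_leg_def all_less_2)

lemma R_coeff_2:
  "R_coeff (Suc 0) [i, k] [j, l] = (if j = i then if l = k then 1 else 0 else 0)"
  "R_coeff 0 [i, k] [j, l] = (if j = k then if l = i then - fps_X else 0 else 0)"
  "R_coeff (Suc (Suc n)) I J = 0"
  by (auto simp: R_coeff_def perm_op_def all_less_2)

lemma R_diff_coeff_2: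
  "R_diff_coeff 0 0 [i, k] [j, l] = (if j = k then if l = i then - scalar fps_X else 0 else 0)"
  "R_diff_coeff (Suc 0) 0 [i, k] [j, l] = (if j = i then if l = k then 1 else 0 else 0)"
  "R_diff_coeff 0 (Suc 0) [i, k] [j, l] = (if j = i then if l = k then - 1 else 0 else 0)"
  "R_diff_coeff (Suc 0) (Suc 0) I J = 0"
  by (simp_all add: R_diff_coeff_def R_coeff_2 scalar_simps)

text \<open>
  The same values with the equations oriented towards the row indices, so that sums over the row
  indices collapse.
\<close>
lemma R_diff_coeff_2_flip:
  "R_diff_coeff 0 0 [i, k] [j, l] = (if i = l then if k = j then - scalar fps_X else 0 else 0)"
  "R_diff_coeff (Suc 0) 0 [i, k] [j, l] = (if i = j then if k = l then 1 else 0 else 0)"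
  "R_diff_coeff 0 (Suc 0) [i, k] [j, l] = (if i = j then if k = l then - 1 else 0 else 0)"
  by (auto simp: R_diff_coeff_2)

lemma tensor_mult_2: "tensor_mult free_alg_ring 2 A B I J = (\<Sum>p\<in>UNIV. \<Sum>q\<in>UNIV. A I [p, q] * B [p, q :: 'n::finite] J)"
  by (simp add: tensor_mult_def sum_multi_indices_2)

lemma if_mult: "(if P then x else 0) * y = (if P then x * y else (0 :: 'a::ring))"
  "y * (if P then x else 0) = (if P then y * x else 0)"
  by auto

lemma sum_if_0: "(\<Sum>p\<in>S. if Q then f p else 0) = (if Q then \<Sum>p\<in>S. f p else (0 :: 'a::ring))"
  by simp

lemma legs_2:
  "tensor_mult free_alg_ring 2 (tensor_leg free_alg_ring 2 0 x) (tensor_leg free_alg_ring 2 1 y) [i, k] [j, l]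
     = x i j * y k (l :: 'n::finite)"
  "tensor_mult free_alg_ring 2 (tensor_leg free_alg_ring 2 1 y) (tensor_leg free_alg_ring 2 0 x) [i, k] [j, l]
     = y k l * x i j"
  by (simp_all add: tensor_mult_2 tensor_leg_2 tensor_leg_2[unfolded One_nat_def] if_mult sum_if_0)

lemma RLL_lhs_entry:
  "RLL_lhs a b [i, k] [j, l :: 'n::finite] = lam i j (- (a - 1)) * lam k l (- b) - lam i j (- a) * lam k l (- (b - 1))
     - scalar fps_X * (lam k j (- a) * lam i l (- b))"
  unfolding RLL_lhs_def tensor_mult_2[of "R_diff_coeff _ _"] legs_2
  by (simp add: R_diff_coeff_2 if_mult sum_if_0 L_coeff_def)

lemma RLL_rhs_entry:
  "RLL_rhs a b [i, k] [j, l :: 'n::finite] = lam k l (- b) * lam i j (- (a - 1)) - lam k l (- (b - 1)) * lam i j (- a)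
     - lam k j (- b) * lam i l (- a) * scalar fps_X"
  unfolding RLL_rhs_def tensor_mult_2[of _ "R_diff_coeff _ _"] legs_2
  by (simp add: R_diff_coeff_2_flip R_diff_coeff_2(4) if_mult sum_if_0 L_coeff_def)

definition crit_lam :: "int \<Rightarrow> 'n::finite \<Rightarrow> 'n \<Rightarrow> 'n crit" where
  "crit_lam r i j = crit (lam i j (- r))"

definition crit_h :: "'n::finite crit" where
  "crit_h = crit (scalar fps_X)"

definition crit_shift :: "nat \<Rightarrow> int \<Rightarrow> int \<Rightarrow> 'n::finite crit" where
  "crit_shift k r n = crit (scalar (shift_pow_coeff (- of_nat k) r n))"

lemma shift_pow_coeff_Pascal:
  "shift_pow_coeff c (r + 1) n = shift_pow_coeff c r (n - 1) + fps_const c * fps_X * shift_pow_coeff c r n"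
proof (cases "n \<le> r")
  case True
  define s where "s = nat (r - n)"
  have s: "nat (r - n) = s" "nat (r + 1 - n) = Suc s" "nat (r - (n - 1)) = Suc s"
    using True by (auto simp: s_def)
  have "(of_int (r + 1) gchoose Suc s) = (of_int r gchoose s) + (of_int r gchoose Suc s :: complex)"
    using gbinomial_Suc_Suc[of "of_int r :: complex" s] by simp
  then have eq: "fps_const ((of_int (r + 1) gchoose Suc s) * c ^ Suc s)
      = fps_const ((of_int r gchoose Suc s) * c ^ Suc s) + fps_const c * fps_const ((of_int r gchoose s) * c ^ s)"
    by (simp add: algebra_simps)
  moreover have "shift_pow_coeff c (r + 1) n = fps_const ((of_int (r + 1) gchoose Suc s) * c ^ Suc s) * fps_X ^ Suc s"
    "shift_pow_coeff c r (n - 1) = fps_const ((of_int r gchoose Suc s) * c ^ Suc s) * fps_X ^ Suc s"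
    "shift_pow_coeff c r n = fps_const ((of_int r gchoose s) * c ^ s) * fps_X ^ s"
    using True by (simp_all only: shift_pow_coeff_def s) auto
  ultimately show ?thesis
    by (simp only: distrib_right power_Suc[of fps_X] mult.assoc mult.left_commute[of fps_X])
next
  case False
  then show ?thesis by (auto simp: shift_pow_coeff_def)
qed

lemma crit_scalar_central: "crit (scalar c) * y = y * crit (scalar c)"
proof -
  obtain x where "y = crit x" using crit_surj by blast
  then show ?thesis by (simp add: crit_simps[symmetric] scalar_central)
qed

lemma crit_half: "y + y = 0 \<Longrightarrow> y = (0 :: 'n::finite crit)"
proof -
  assume y: "y + y = 0"
  let ?c = "crit (scalar (fps_const (1 / 2)))"
  have "?c * (y + y) = (?c + ?c) * y" by (simp add: distrib_left distrib_right)
  also have "?c + ?c = 1" by (simp add: crit_simps[symmetric] scalar_simps[symmetric])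
  finally show "y = 0" using y by simp
qed

lemma crit_lam_top: "r > int (critical_level TYPE('n::finite)) \<Longrightarrow> crit_lam r i j = (0 :: 'n crit)"
  using crit_eq_iff[of "lam i j (- r)" 0] by (simp add: crit_lam_def proj_lam crit_simps)

lemma of_nat_crit: "crit (scalar (of_nat k)) = of_nat k"
  by (induction k) (simp_all add: scalar_simps crit_simps)

interpretation crit: RLL_level "int (critical_level TYPE('n::finite))" "crit_h :: 'n crit" crit_lam crit_shift
proof
  fix y :: "'n crit" and k r n a b and i j c d :: 'n
  show "crit_h * y = y * crit_h" unfolding crit_h_def by (rule crit_scalar_central)
  show "y = 0" if "y + y = 0" using that by (rule crit_half)
  show "crit_lam r i j = (0 :: 'n crit)" if "r > int (critical_level TYPE('n))" using that by (rule crit_lam_top)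
  show "crit_shift k r n * y = y * crit_shift k r n" unfolding crit_shift_def by (rule crit_scalar_central)
  show "crit_shift k r n = (0 :: 'n crit)" if "n > r"
    using that by (simp add: crit_shift_def shift_pow_coeff_def scalar_simps crit_simps)
  have "scalar (shift_pow_coeff (- of_nat k) (r + 1) n) = (scalar (shift_pow_coeff (- of_nat k) r (n - 1))
     - scalar (of_nat k) * scalar fps_X * scalar (shift_pow_coeff (- of_nat k) r n) :: 'n free_alg)"
    unfolding shift_pow_coeff_Pascal by (simp add: scalar_simps[symmetric] fps_of_nat[symmetric] fps_const_neg[symmetric] del: fps_const_neg)
  then show "crit_shift k (r + 1) n = (crit_shift k r (n - 1) - of_nat k * crit_h * crit_shift k r n :: 'n crit)"
    by (simp add: crit_shift_def crit_h_def of_nat_crit[symmetric] crit_simps[symmetric])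
  have "crit (RLL_lhs a b [i, c] [j, d]) = crit (RLL_rhs a b [i, c] [j, d])"
    unfolding crit_eq_iff by (rule proj_RLL) simp_all
  then show "crit_lam (a - 1) i j * crit_lam b c d - crit_lam b c d * crit_lam (a - 1) i j
      - (crit_lam a i j * crit_lam (b - 1) c d - crit_lam (b - 1) c d * crit_lam a i j)
      = crit_h * (crit_lam a c j * crit_lam b i d - crit_lam b c j * crit_lam a i d)"
    using crit_scalar_central[of fps_X "crit_lam b c j * crit_lam a i d"]
    by (simp add: RLL_lhs_entry RLL_rhs_entry crit_simps crit_lam_def crit_h_def algebra_simps)
qed

section \<open>The series at the critical level\<close>

lemma finsum_Y_level_zero:
  assumes "\<And>i. i \<in> S \<Longrightarrow> f i = \<zero>\<^bsub>Y_level p\<^esub>"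
  shows "(\<Oplus>\<^bsub>Y_level p\<^esub> i \<in> S. f i) = (\<zero>\<^bsub>Y_level p\<^esub> :: 'n::finite free_alg set set)"
proof -
  interpret ring "Y_level p :: 'n free_alg set set ring" by (rule ring_Y_level)
  show ?thesis using assms by (rule add.finprod_one_eqI)
qed

lemma Y_level_zero_mult:
  assumes "x \<in> carrier (Y_level p :: 'n::finite free_alg set set ring)"
  shows "x \<otimes>\<^bsub>Y_level p\<^esub> \<zero>\<^bsub>Y_level p\<^esub> = \<zero>\<^bsub>Y_level p\<^esub>" "\<zero>\<^bsub>Y_level p\<^esub> \<otimes>\<^bsub>Y_level p\<^esub> x = \<zero>\<^bsub>Y_level p\<^esub>"
proof -
  interpret ring "Y_level p :: 'n free_alg set set ring" by (rule ring_Y_level)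
  show "x \<otimes>\<^bsub>Y_level p\<^esub> \<zero>\<^bsub>Y_level p\<^esub> = \<zero>\<^bsub>Y_level p\<^esub>" "\<zero>\<^bsub>Y_level p\<^esub> \<otimes>\<^bsub>Y_level p\<^esub> x = \<zero>\<^bsub>Y_level p\<^esub>"
    using assms by simp_all
qed

text \<open>
  At every level the exponents are bounded above, uniformly in the matrix indices.  For such
  series only finitely many terms of a Cauchy product survive at each level.
\<close>
definition Y_bounded :: "'n::finite Y_mat_series \<Rightarrow> bool" where
  "Y_bounded A \<longleftrightarrow> (\<forall>n I J. A n I J \<in> carrier Y_compl) \<and>
     (\<forall>p. \<exists>B. \<forall>n>B. \<forall>I J. A n I J p = \<zero>\<^bsub>Y_level p\<^esub>)"

lemma Y_bounded_carrier: "Y_bounded A \<Longrightarrow> A n I J \<in> carrier Y_compl"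
  by (simp add: Y_bounded_def)

lemma Y_compl_zero_carrier: "\<zero>\<^bsub>Y_compl\<^esub> \<in> carrier Y_compl"
  by (rule ring.ring_simprules(2)[OF ring_Y_compl])

lemma Y_compl_one_carrier: "\<one>\<^bsub>Y_compl\<^esub> \<in> carrier Y_compl"
  by (rule ring.ring_simprules(6)[OF ring_Y_compl])

lemma Y_compl_mult_carrier: "x \<in> carrier Y_compl \<Longrightarrow> y \<in> carrier Y_compl \<Longrightarrow> x \<otimes>\<^bsub>Y_compl\<^esub> y \<in> carrier Y_compl"
  by (rule ring.ring_simprules(5)[OF ring_Y_compl])

lemma Y_compl_finsum_carrier:
  assumes "\<And>i. i \<in> S \<Longrightarrow> f i \<in> carrier (Y_compl :: 'n::finite Y_compl_elem ring)"
  shows "(\<Oplus>\<^bsub>Y_compl\<^esub> i \<in> S. f i) \<in> carrier Y_compl"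
proof -
  interpret ring "Y_compl :: 'n Y_compl_elem ring" by (rule ring_Y_compl)
  show ?thesis using assms by (intro finsum_closed) auto
qed

lemma tensor_mult_carrier:
  assumes "\<And>I J. A I J \<in> carrier Y_compl" "\<And>I J. B I J \<in> carrier Y_compl"
  shows "tensor_mult Y_compl m A B I J \<in> carrier (Y_compl :: 'n::finite Y_compl_elem ring)"
  unfolding tensor_mult_def by (intro Y_compl_finsum_carrier Y_compl_mult_carrier assms)

lemma tensor_mult_zero:
  assumes c: "\<And>I J. A I J \<in> carrier Y_compl" "\<And>I J. B I J \<in> carrier (Y_compl :: 'n::finite Y_compl_elem ring)"
    and z: "(\<forall>I J. A I J p = \<zero>\<^bsub>Y_level p\<^esub>) \<or> (\<forall>I J. B I J p = \<zero>\<^bsub>Y_level p\<^esub>)"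
  shows "tensor_mult Y_compl m A B I J p = \<zero>\<^bsub>Y_level p\<^esub>"
proof -
  have "tensor_mult Y_compl m A B I J p = (\<Oplus>\<^bsub>Y_level p\<^esub> K \<in> multi_indices m. (A I K \<otimes>\<^bsub>Y_compl\<^esub> B K J) p)"
    unfolding tensor_mult_def by (intro finsum_Y_compl_component Y_compl_mult_carrier c)
  also have "\<dots> = \<zero>\<^bsub>Y_level p\<^esub>"
    by (rule finsum_Y_level_zero)
       (use z in \<open>auto simp: Y_compl_simps Y_level_zero_mult Y_compl_component[OF c(1)] Y_compl_component[OF c(2)]\<close>)
  finally show ?thesis .
qed

lemma crit_val_tensor_mult:
  assumes "\<And>I J. A I J \<in> carrier Y_compl" "\<And>I J. B I J \<in> carrier (Y_compl :: 'n::finite Y_compl_elem ring)"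
  shows "crit_val (tensor_mult Y_compl m A B I J) = (\<Sum>K\<in>multi_indices m. crit_val (A I K) * crit_val (B K J))"
  unfolding tensor_mult_def by (subst crit_val_sum) (use assms in \<open>auto intro: Y_compl_mult_carrier\<close>)

lemma Y_series_mult_summable:
  assumes A: "Y_bounded A" and B: "Y_bounded (B :: 'n::finite Y_mat_series)"
  shows "finite {k. tensor_mult Y_compl m (A k) (B (n - k)) I J p \<noteq> \<zero>\<^bsub>Y_level p\<^esub>}"
    and "\<exists>M. \<forall>n>M. \<forall>I J. {k. tensor_mult Y_compl m (A k) (B (n - k)) I J p \<noteq> \<zero>\<^bsub>Y_level p\<^esub>} = {}"
proof -
  obtain b c where b: "\<forall>n>b. \<forall>I J. A n I J p = \<zero>\<^bsub>Y_level p\<^esub>" and c: "\<forall>n>c. \<forall>I J. B n I J p = \<zero>\<^bsub>Y_level p\<^esub>"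
    using A B unfolding Y_bounded_def by meson
  have sub: "{k. tensor_mult Y_compl m (A k) (B (n - k)) I J p \<noteq> \<zero>\<^bsub>Y_level p\<^esub>} \<subseteq> {n - c..b}" for n I J
  proof
    fix k assume k: "k \<in> {k. tensor_mult Y_compl m (A k) (B (n - k)) I J p \<noteq> \<zero>\<^bsub>Y_level p\<^esub>}"
    show "k \<in> {n - c..b}"
    proof (rule ccontr)
      assume "k \<notin> {n - c..b}"
      then have "k > b \<or> n - k > c" by auto
      then have "tensor_mult Y_compl m (A k) (B (n - k)) I J p = \<zero>\<^bsub>Y_level p\<^esub>"
        using b c by (intro tensor_mult_zero Y_bounded_carrier A B) auto
      with k show False by simp
    qed
  qed
  show "finite {k. tensor_mult Y_compl m (A k) (B (n - k)) I J p \<noteq> \<zero>\<^bsub>Y_level p\<^esub>}"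
    by (rule finite_subset[OF sub]) simp
  have "{k. tensor_mult Y_compl m (A k) (B (n - k)) I J p \<noteq> \<zero>\<^bsub>Y_level p\<^esub>} = {}" if "n > b + c" for n I J
    using sub[of n I J] that by auto
  then show "\<exists>M. \<forall>n>M. \<forall>I J. {k. tensor_mult Y_compl m (A k) (B (n - k)) I J p \<noteq> \<zero>\<^bsub>Y_level p\<^esub>} = {}"
    by blast
qed

lemma Y_bounded_mult:
  assumes A: "Y_bounded A" and B: "Y_bounded (B :: 'n::finite Y_mat_series)"
  shows "Y_bounded (Y_series_mult m A B)"
proof -
  note summable = Y_series_mult_summable[OF A B]
  have car: "tensor_mult Y_compl m (A k) (B l) I J \<in> carrier Y_compl" for k l I J
    by (intro tensor_mult_carrier Y_bounded_carrier A B)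
  have comp: "Y_series_mult m A B n I J p = (\<Oplus>\<^bsub>Y_level p\<^esub> k \<in> {k. tensor_mult Y_compl m (A k) (B (n - k)) I J p \<noteq> \<zero>\<^bsub>Y_level p\<^esub>}.
      tensor_mult Y_compl m (A k) (B (n - k)) I J p)" for n I J p
    unfolding Y_series_mult_def by (rule Y_compl_sum_component(2)[OF car summable(1)])
  have "\<exists>M. \<forall>n>M. \<forall>I J. Y_series_mult m A B n I J p = \<zero>\<^bsub>Y_level p\<^esub>" for p
  proof -
    obtain M where "\<forall>n>M. \<forall>I J. {k. tensor_mult Y_compl m (A k) (B (n - k)) I J p \<noteq> \<zero>\<^bsub>Y_level p\<^esub>} = {}"
      using summable(2) by blast
    then have "\<forall>n>M. \<forall>I J. Y_series_mult m A B n I J p = \<zero>\<^bsub>Y_level p\<^esub>"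
      unfolding comp by (auto intro!: finsum_Y_level_zero)
    then show ?thesis by blast
  qed
  moreover have "Y_series_mult m A B n I J \<in> carrier Y_compl" for n I J
    unfolding Y_series_mult_def by (rule Y_compl_sum_component(1)[OF car summable(1)])
  ultimately show ?thesis by (simp add: Y_bounded_def)
qed

lemma crit_val_Y_series_mult:
  assumes A: "Y_bounded A" and B: "Y_bounded (B :: 'n::finite Y_mat_series)" and W: "finite W"
    and out: "\<And>k. k \<notin> W \<Longrightarrow> (\<Sum>K\<in>multi_indices m. crit_val (A k I K) * crit_val (B (n - k) K J)) = 0"
  shows "crit_val (Y_series_mult m A B n I J)
    = (\<Sum>k\<in>W. \<Sum>K\<in>multi_indices m. crit_val (A k I K) * crit_val (B (n - k) K J))"
proof -
  have val: "crit_val (tensor_mult Y_compl m (A k) (B (n - k)) I J)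
      = (\<Sum>K\<in>multi_indices m. crit_val (A k I K) * crit_val (B (n - k) K J))" for k
    by (intro crit_val_tensor_mult Y_bounded_carrier A B)
  have "crit_val (Y_series_mult m A B n I J) = (\<Sum>k\<in>W. crit_val (tensor_mult Y_compl m (A k) (B (n - k)) I J))"
    unfolding Y_series_mult_def
    by (intro crit_val_Y_compl_sum tensor_mult_carrier Y_bounded_carrier A B Y_series_mult_summable W) (simp add: val out)
  then show ?thesis by (simp only: val)
qed

lemma L_shift_term_zero:
  assumes "r \<notin> {n..int p}"
  shows "to_Y_compl (scalar (shift_pow_coeff c r n) * L_coeff r i j) p = (\<zero>\<^bsub>Y_level p\<^esub> :: 'n::finite free_alg set set)"
proof (cases "r > int p")
  case True
  have "proj p (scalar (shift_pow_coeff c r n) * L_coeff r i j) = (proj p (scalar (shift_pow_coeff c r n) * 0) :: 'n free_alg set set)"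
    by (simp only: proj_simps(2) L_coeff_def proj_lam[OF True])
  then show ?thesis by (simp add: proj_def[symmetric] proj_simps(4))
next
  case False
  then have "shift_pow_coeff c r n = 0" using assms by (simp add: shift_pow_coeff_def)
  then show ?thesis by (simp add: proj_def[symmetric] scalar_simps proj_simps(4))
qed

lemma L_shift_summable:
  "finite {r. to_Y_compl (scalar (shift_pow_coeff c r n) * L_coeff r i j) p \<noteq> (\<zero>\<^bsub>Y_level p\<^esub> :: 'n::finite free_alg set set)}"
  by (rule finite_subset[of _ "{n..int p}"]) (use L_shift_term_zero in blast)+

lemma L_shift_coeff_carrier: "L_shift_coeff c n i j \<in> carrier Y_compl"
  unfolding L_shift_coeff_def by (intro Y_compl_sum_component(1) to_Y_compl_carrier L_shift_summable)

lemma L_shift_coeff_zero: "n > int p \<Longrightarrow> L_shift_coeff c n i j p = \<zero>\<^bsub>Y_level p\<^esub>"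
  unfolding L_shift_coeff_def
  by (subst Y_compl_sum_component(2)[OF to_Y_compl_carrier L_shift_summable], rule finsum_Y_level_zero)
     (rule L_shift_term_zero, simp)

lemma crit_val_L_shift_coeff:
  "crit_val (L_shift_coeff (- of_nat k) n i (j :: 'n::finite)) = fls_nth (crit.L k i j) (- n)"
proof -
  let ?p = "int (critical_level TYPE('n))"
  have "crit_val (L_shift_coeff (- of_nat k) n i j)
      = (\<Sum>r\<in>{n..?p}. crit_val (to_Y_compl (scalar (shift_pow_coeff (- of_nat k) r n) * L_coeff r i j)))"
    unfolding L_shift_coeff_def
    by (intro crit_val_Y_compl_sum to_Y_compl_carrier L_shift_summable)
       (simp, unfold crit_val_eq_0_iff[OF to_Y_compl_carrier], rule L_shift_term_zero)
  also have "\<dots> = (\<Sum>r\<in>{n..?p}. crit_shift k r n * crit_lam r i j)"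
    by (simp add: crit_simps crit_shift_def crit_lam_def L_coeff_def)
  also have "\<dots> = fls_nth (crit.L k i j) (- n)"
    by (subst crit.L_nth[of "{n..?p}"]) auto
  finally show ?thesis .
qed

lemma Y_bounded_leg: "Y_bounded (\<lambda>n. tensor_leg Y_compl m k (L_shift_coeff c n) :: ('n::finite, 'n Y_compl_elem) tensor_mat)"
proof -
  have "tensor_leg Y_compl m k (L_shift_coeff c n) I J p = \<zero>\<^bsub>Y_level p\<^esub>" if "n > int p" for n I p and J :: "'n list"
    by (simp add: tensor_leg_def Y_compl_simps L_shift_coeff_zero[OF that])
  moreover have "tensor_leg Y_compl m k (L_shift_coeff c n) I J \<in> carrier Y_compl" for n I and J :: "'n list"
    by (simp add: tensor_leg_def L_shift_coeff_carrier Y_compl_zero_carrier)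
  ultimately show ?thesis unfolding Y_bounded_def by blast
qed

lemma Y_bounded_L_prod: "Y_bounded (L_prod m k :: 'n::finite Y_mat_series)"
proof (induction k)
  case 0
  have "Y_series_one n I J p = \<zero>\<^bsub>Y_level p\<^esub>" if "n > 0" for n p and I J :: "'n list"
    using that by (simp add: Y_series_one_def Y_compl_simps)
  moreover have "Y_series_one n I J \<in> carrier Y_compl" for n and I J :: "'n list"
    by (simp add: Y_series_one_def tensor_one_def Y_compl_zero_carrier Y_compl_one_carrier)
  ultimately show ?case unfolding Y_bounded_def L_prod.simps by blast
next
  case (Suc k)
  then show ?case unfolding L_prod.simps by (intro Y_bounded_mult Y_bounded_leg)
qed

text \<open>
  The matrix entry of a product of matrices in different tensor factors is the product of their
  entries, provided that the indices agree in the remaining factors; otherwise it vanishes.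
\<close>
lemma crit_val_L_prod:
  fixes I J :: "'n::finite list"
  assumes "length I = m" "length J = m" "k \<le> m"
  shows "crit_val (L_prod m k n I J) = (if \<forall>l<m. k \<le> l \<longrightarrow> I ! l = J ! l
     then fls_nth (prod_list (map (\<lambda>q. crit.L q (I ! q) (J ! q)) [0..<k])) (- n) else 0)"
  using assms
proof (induction k arbitrary: n J)
  case 0
  then have "(\<forall>l<m. I ! l = J ! l) \<longleftrightarrow> I = J" by (auto simp: list_eq_iff_nth_eq)
  then show ?case by (simp add: Y_series_one_def tensor_one_def)
next
  case (Suc k)
  let ?N = "int (critical_level TYPE('n))"
  let ?agree = "\<forall>l<m. Suc k \<le> l \<longrightarrow> I ! l = J ! l"
  define f where "f = prod_list (map (\<lambda>q. crit.L q (I ! q) (J ! q)) [0..<k])"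
  define g where "g = crit.L k (I ! k) (J ! k)"
  define W where "W = {n - ?N..- fls_subdegree f}"
  have k: "k < m" using Suc.prems by simp
  \<comment> \<open>The only intermediate index that contributes to the product with the next factor.\<close>
  define K0 where "K0 = J[k := I ! k]"
  have inner: "(\<Sum>K\<in>multi_indices m. crit_val (L_prod m k t I K) * crit_val (tensor_leg Y_compl m k (L_shift_coeff (- of_nat k) s) K J))
      = (if ?agree then fls_nth f (- t) * fls_nth g (- s) else 0)" for t s
  proof -
    have summand: "crit_val (L_prod m k t I K) * crit_val (tensor_leg Y_compl m k (L_shift_coeff (- of_nat k) s) K J)
        = (if K = K0 then if ?agree then fls_nth f (- t) * fls_nth g (- s) else 0 else 0)"
      if "K \<in> multi_indices m" for K
    proof -
      have K: "length K = m" using that by (simp add: multi_indices_def)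
      have val: "crit_val (L_prod m k t I K) = (if \<forall>l<m. k \<le> l \<longrightarrow> I ! l = K ! l
         then fls_nth (prod_list (map (\<lambda>q. crit.L q (I ! q) (K ! q)) [0..<k])) (- t) else 0)"
        using Suc.prems by (intro Suc.IH K) auto
      have leg: "crit_val (tensor_leg Y_compl m k (L_shift_coeff (- of_nat k) s) K J)
        = (if \<forall>l<m. l \<noteq> k \<longrightarrow> K ! l = J ! l then fls_nth (crit.L k (K ! k) (J ! k)) (- s) else 0)"
        unfolding tensor_leg_def if_distrib[of crit_val] crit_val_L_shift_coeff crit_val_zero ..
      show ?thesis
      proof (cases "(\<forall>l<m. k \<le> l \<longrightarrow> I ! l = K ! l) \<and> (\<forall>l<m. l \<noteq> k \<longrightarrow> K ! l = J ! l)")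
        case True
        then have rows: "\<forall>l<m. k \<le> l \<longrightarrow> I ! l = K ! l"
          and cols: "\<forall>l<m. l \<noteq> k \<longrightarrow> K ! l = J ! l" by auto
        have K0: "K = K0" using True K Suc.prems k by (auto simp: K0_def list_eq_iff_nth_eq nth_list_update)
        have agree: ?agree using True by auto
        have prod: "prod_list (map (\<lambda>q. crit.L q (I ! q) (K ! q)) [0..<k]) = f"
          unfolding f_def by (rule arg_cong[where f = prod_list]) (use True k in auto)
        have "K ! k = I ! k" using True k by auto
        then show ?thesis
          unfolding val leg prod g_def if_P[OF rows] if_P[OF cols] if_P[OF K0] if_P[OF agree] by (rule arg_cong)
      next
        case False
        have "K \<noteq> K0 \<or> \<not> ?agree"
        proof (rule ccontr)
          assume "\<not> ?thesis"
          then have "K = K0" ?agree by auto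
          then have "(\<forall>l<m. k \<le> l \<longrightarrow> I ! l = K ! l) \<and> (\<forall>l<m. l \<noteq> k \<longrightarrow> K ! l = J ! l)"
            using Suc.prems k by (auto simp: K0_def nth_list_update)
          with False show False ..
        qed
        then show ?thesis using False unfolding val leg by auto
      qed
    qed
    have "K0 \<in> multi_indices m" using Suc.prems by (simp add: K0_def multi_indices_def)
    then show ?thesis by (simp add: summand cong: sum.cong)
  qed
  have f: "fls_nth f t = 0" if "t < - (- fls_subdegree f)" for t using that by simp
  have g: "fls_nth g t = 0" if "t < - ?N" for t unfolding g_def using that by (rule crit.L_top)
  have "crit_val (L_prod m (Suc k) n I J) = (\<Sum>t\<in>W. if ?agree then fls_nth f (- t) * fls_nth g (- (n - t)) else 0)"
    unfolding L_prod.simps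
  proof (subst crit_val_Y_series_mult[OF Y_bounded_L_prod Y_bounded_leg, where W = W])
    fix t assume "t \<notin> W"
    then have "fls_nth f (- t) = 0 \<or> fls_nth g (- (n - t)) = 0" using f[of "- t"] g[of "- (n - t)"] by (auto simp: W_def)
    then show "(\<Sum>K\<in>multi_indices m. crit_val (L_prod m k t I K) * crit_val (tensor_leg Y_compl m k (L_shift_coeff (- of_nat k) (n - t)) K J)) = 0"
      unfolding inner by auto
  qed (simp_all add: inner W_def)
  also have "\<dots> = (if ?agree then fls_nth (f * g) (- n) else 0)"
  proof -
    have "fls_nth (f * g) (- n) = (\<Sum>t\<in>W. fls_nth f (- t) * fls_nth g (- (n - t)))"
      by (rule fls_times_nth_window[where p = "- fls_subdegree f" and q = ?N]) (use f g in \<open>auto simp: W_def\<close>)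
    then show ?thesis by (cases ?agree) (simp_all only: if_True if_False if_P sum.neutral_const)
  qed
  also have "f * g = prod_list (map (\<lambda>q. crit.L q (I ! q) (J ! q)) [0..<Suc k])"
    by (simp add: f_def g_def)
  finally show ?case .
qed

definition antisym_scalar :: "'n list \<Rightarrow> 'n list \<Rightarrow> 'n::finite crit" where
  "antisym_scalar I J = crit (scalar (fps_const (antisymmetrizer CARD('n) I J)))"

text \<open>Swapping two entries of \<open>J\<close> amounts to composing every permutation with a transposition.\<close>
lemma alternating_antisymmetrizer: "alternating m (antisymmetrizer m I)"
proof (rule alternatingI)
  fix J :: "'a list" and k assume J: "length J = m" and k: "Suc k < m"
  define \<tau> where "\<tau> = Transposition.transpose k (Suc k)"
  have \<tau>: "\<tau> permutes {..<m}" unfolding \<tau>_def using k by (intro permutes_swap_id) auto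
  have perm: "perm_op m \<sigma> I (J[k := J ! Suc k, Suc k := J ! k]) = (perm_op m (\<sigma> \<circ> \<tau>) I J :: complex)" for \<sigma>
  proof -
    have nth: "J[k := J ! Suc k, Suc k := J ! k] ! q = J ! \<tau> q" if "q < m" for q
      using that k J by (auto simp: \<tau>_def transpose_def nth_list_update)
    have "(\<forall>q<m. I ! \<sigma> q = J ! \<tau> q) \<longleftrightarrow> (\<forall>q<m. I ! \<sigma> (\<tau> q) = J ! q)"
    proof -
      have "\<tau> (\<tau> q) = q" for q by (simp add: \<tau>_def)
      moreover have "\<tau> q < m \<longleftrightarrow> q < m" for q using permutes_in_image[OF \<tau>, of q] by simp
      ultimately show ?thesis by metis
    qed
    then show ?thesis by (simp add: perm_op_def nth cong: if_cong)
  qed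
  have "(\<Sum>\<sigma> | \<sigma> permutes {..<m}. of_int (sign \<sigma>) * (perm_op m (\<sigma> \<circ> \<tau>) I J :: complex))
      = (\<Sum>\<sigma> | \<sigma> permutes {..<m}. - (of_int (sign \<sigma>) * perm_op m \<sigma> I J))"
  proof (rule sum.reindex_bij_witness[where i = "\<lambda>\<sigma>. \<sigma> \<circ> \<tau>" and j = "\<lambda>\<sigma>. \<sigma> \<circ> \<tau>"])
    have invol: "\<tau> \<circ> \<tau> = id" by (simp add: \<tau>_def fun_eq_iff)
    show "\<sigma> \<circ> \<tau> \<circ> \<tau> = \<sigma>" "\<sigma> \<circ> \<tau> \<circ> \<tau> = \<sigma>" for \<sigma> :: "nat \<Rightarrow> nat" by (simp_all add: comp_assoc invol)
    show "\<sigma> \<circ> \<tau> \<in> {\<sigma>. \<sigma> permutes {..<m}}" "\<sigma> \<circ> \<tau> \<in> {\<sigma>. \<sigma> permutes {..<m}}"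
      if "\<sigma> \<in> {\<sigma>. \<sigma> permutes {..<m}}" for \<sigma>
      using that permutes_compose[OF \<tau>] by auto
    fix \<sigma> assume "\<sigma> \<in> {\<sigma>. \<sigma> permutes {..<m}}"
    then have "permutation \<sigma>" "permutation \<tau>" using \<tau> by (auto simp: permutation_permutes)
    then have "sign (\<sigma> \<circ> \<tau>) = - sign \<sigma>" by (simp add: sign_compose) (simp add: \<tau>_def sign_swap_id)
    then show "- (of_int (sign (\<sigma> \<circ> \<tau>)) * perm_op m (\<sigma> \<circ> \<tau>) I J)
        = of_int (sign \<sigma>) * (perm_op m (\<sigma> \<circ> \<tau>) I J :: complex)"
      by simp
  qed
  then show "antisymmetrizer m I (J[k := J ! Suc k, Suc k := J ! k]) = - antisymmetrizer m I J"
    by (simp add: antisymmetrizer_def perm sum_negf)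
qed simp

lemma alternating_antisym_scalar: "alternating CARD('n) (antisym_scalar I :: 'n list \<Rightarrow> 'n::finite crit)"
proof -
  have "alternating CARD('n) (antisymmetrizer CARD('n) I)" by (rule alternating_antisymmetrizer)
  then show ?thesis
    unfolding alternating_def antisym_scalar_def
    by (auto simp: fps_const_neg[symmetric] scalar_simps crit_simps simp del: fps_const_neg)
qed

lemma tensor_trace_val:
  assumes "\<And>I J. A I J \<in> carrier (Y_compl :: 'n::finite Y_compl_elem ring)"
  shows "crit_val (tensor_trace Y_compl m A) = (\<Sum>I\<in>multi_indices m. crit_val (A I I))"
  unfolding tensor_trace_def by (intro crit_val_sum assms)

text \<open>
  Each diagonal entry of \<open>A\<^sub>(\<^sub>N\<^sub>) \<L>\<^sub>1(z) \<dots> \<L>\<^sub>N(z - (N - 1) h)\<close> is an alternating combination of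
  products, with the row \<open>I\<close> of the antisymmetrizer as weights.
\<close>
lemma crit_val_LL_coeff:
  "crit_val (LL_coeff n :: 'n::finite Y_compl_elem)
   = (\<Sum>I\<in>multi_indices CARD('n). fls_nth (crit.det_series (antisym_scalar I) I) (- n))"
proof -
  let ?N = "CARD('n)"
  have "crit_val (LL_coeff n :: 'n Y_compl_elem) = (\<Sum>I\<in>multi_indices ?N. \<Sum>K\<in>multi_indices ?N.
     antisym_scalar I K * crit_val (L_prod ?N ?N n K I))"
    unfolding LL_coeff_def
    by (subst tensor_trace_val)
       (simp_all add: tensor_mult_carrier crit_val_tensor_mult to_Y_compl_carrier Y_bounded_carrier[OF Y_bounded_L_prod]
          antisym_scalar_def)
  also have "\<dots> = (\<Sum>I\<in>multi_indices ?N. \<Sum>K\<in>multi_indices ?N.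
     antisym_scalar I K * fls_nth (prod_list (map (\<lambda>q. crit.L q (K ! q) (I ! q)) [0..<?N])) (- n))"
    by (intro sum.cong refl) (subst crit_val_L_prod, auto simp: multi_indices_def)
  finally show ?thesis
    by (simp add: crit.det_series_def fls_nth_sum)
qed

lemma LL_coeff_carrier: "(LL_coeff n :: 'n::finite Y_compl_elem) \<in> carrier Y_compl"
  unfolding LL_coeff_def tensor_trace_def
  by (intro Y_compl_finsum_carrier tensor_mult_carrier to_Y_compl_carrier Y_bounded_carrier[OF Y_bounded_L_prod])

lemma LL_coeff_commute_crit: "crit_val (LL_coeff n) * y = y * crit_val (LL_coeff n :: 'n::finite Y_compl_elem)"
proof (induction y rule: crit_induct)
  case (scalar c)
  then show ?case by (rule crit_scalar_central[symmetric])
next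
  case (lam i j r)
  have "antisym_scalar I K * y = y * antisym_scalar I K" for I K :: "'n list" and y
    unfolding antisym_scalar_def by (rule crit_scalar_central)
  then have "crit_lam (- r) i j * fls_nth (crit.det_series (antisym_scalar I) I) (- n)
      = fls_nth (crit.det_series (antisym_scalar I) I) (- n) * crit_lam (- r) i j" if "I \<in> multi_indices CARD('n)" for I
    using that by (intro crit.det_series_commute alternating_antisym_scalar) (auto simp: multi_indices_def)
  then show ?case
    unfolding crit_val_LL_coeff sum_distrib_left sum_distrib_right
    by (intro sum.cong refl) (simp add: crit_lam_def)
next
  case (add x y)
  then show ?case by (simp add: distrib_left distrib_right)
next
  case (mult x y)
  then show ?case by (metis mult.assoc)
qed

text \<open>
  If this failed at any level, it would fail at the critical level, by the choice of the latter.
\<close>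
lemma LL_coeff_commute_level:
  "(LL_coeff n :: 'n::finite Y_compl_elem) p \<otimes>\<^bsub>Y_level p\<^esub> proj p y = proj p y \<otimes>\<^bsub>Y_level p\<^esub> LL_coeff n p"
proof (rule ccontr)
  let ?p = "critical_level TYPE('n)"
  assume "\<not> ?thesis"
  then have "\<exists>p n y. (LL_coeff n :: 'n Y_compl_elem) p \<otimes>\<^bsub>Y_level p\<^esub> proj p y \<noteq> proj p y \<otimes>\<^bsub>Y_level p\<^esub> LL_coeff n p"
    by blast
  then have "\<exists>n y. (LL_coeff n :: 'n Y_compl_elem) ?p \<otimes>\<^bsub>Y_level ?p\<^esub> crit_proj y \<noteq> crit_proj y \<otimes>\<^bsub>Y_level ?p\<^esub> LL_coeff n ?p"
    unfolding critical_level_def by (rule someI_ex)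
  then obtain n y where "(LL_coeff n :: 'n Y_compl_elem) ?p \<otimes>\<^bsub>Y_level ?p\<^esub> crit_proj y \<noteq> crit_proj y \<otimes>\<^bsub>Y_level ?p\<^esub> LL_coeff n ?p"
    by blast
  moreover obtain x where x: "(LL_coeff n :: 'n Y_compl_elem) ?p = crit_proj x"
    using carrier_crit_proj[OF LL_coeff_carrier] by blast
  ultimately have "crit x * crit y \<noteq> crit y * crit x"
    by (simp add: crit_simps[symmetric] crit_eq_iff proj_simps)
  then show False using LL_coeff_commute_crit[of n "crit y"] crit_val_eq[of "LL_coeff n" x, OF x] by simp
qed

section \<open>Centrality\<close>

theorem theorem7p3:
  assumes "CARD('n::finite) \<ge> 2"
  shows "\<forall>n::int. (LL_coeff n :: 'n Y_compl_elem) \<in> ring_center Y_compl"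
proof
  fix n
  have "LL_coeff n \<otimes>\<^bsub>Y_compl\<^esub> y = y \<otimes>\<^bsub>Y_compl\<^esub> (LL_coeff n :: 'n Y_compl_elem)" if y: "y \<in> carrier Y_compl" for y
  proof
    fix p
    obtain z where "y p = proj p z" using Y_compl_component[OF y, of p] by (auto simp: carrier_Y_level)
    then show "(LL_coeff n \<otimes>\<^bsub>Y_compl\<^esub> y) p = (y \<otimes>\<^bsub>Y_compl\<^esub> LL_coeff n) p"
      by (simp add: Y_compl_simps LL_coeff_commute_level)
  qed
  then show "(LL_coeff n :: 'n Y_compl_elem) \<in> ring_center Y_compl"
    by (simp add: ring_center_def LL_coeff_carrier)
qed

end
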